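(* Let $T$ be a finite looped tree. Then the following are equivalent: (1) $\mathrm{Hom}(\mathcal{G},T)$ satisfies topological strong spatial mixing (TSSM) for every board $\mathcal{G}$; (2) $\mathrm{Hom}(\mathbb{Z}^2,T)$ satisfies TSSM; (3) for every $\gamma>0$ there exists a nearest-neighbour interaction $\Phi$ for $T$ such that the Gibbs $(\mathbb{Z}^2,T,\Phi)$-specification satisfies exponential strong spatial mixing with decay rate $\gamma$.
   Context: Graphs are undirected; $u\sim v$ denotes adjacency. A tree is a connected graph with no cycles (in particular no loops); a looped tree is a tree together with possibly some loops. A board is a countable, simple (loopless), connected, locally finite graph $\mathcal{G}=(\mathcal{V},\mathcal{E})$ with at least two vertices. $\mathbb{Z}^2$ denotes the board with vertex set $\mathbb{Z}^2$ and $x\sim y$ iff $\|x-y\|_1=1$. Below $H=(V,E)$ is a finite graph, loops allowed (here $H=T$). $\mathrm{Hom}(\mathcal{G},H)$ is the set of graph homomorphisms $\omega:\mathcal{V}\to V$ (points). $\mathrm{dist}$ is graph distance in $\mathcal{G}$, $\mathrm{dist}(A,B)=\min_{x\in A,y\in B}\mathrm{dist}(x,y)$, $\mathrm{dist}(\cdot,\emptyset)=\infty$ (decay functions take the value $0$ at $\infty$), $\partial A=\{x:\mathrm{dist}(x,A)=1\}$, $\Sigma_B(\alpha_1,\alpha_2)=\{x\in B:\alpha_1(x)\ne\alpha_2(x)\}$. For $A\subseteq\mathcal{V}$, $\alpha\in V^A$ is globally admissible if $\alpha=\omega|_A$ for some point $\omega$. Concatenations such as $\alpha\beta$ denote the common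 extension of configurations on disjoint sets. $\mathbb{N}=\{0,1,2,\dots\}$. TSSM: there is $g\in\mathbb{N}$ such that for all pairwise disjoint finite $A,B,S\subseteq\mathcal{V}$ with $\mathrm{dist}(A,B)\ge g$ and all $\alpha\in V^A,\beta\in V^B,\sigma\in V^S$, if $\alpha\sigma$ and $\sigma\beta$ are globally admissible then $\alpha\sigma\beta$ is globally admissible. Gibbs specification: a nearest-neighbour interaction for $H$ is a function $\Phi:V\cup E\to(-\infty,0]$; write $\Phi(u,v)=\Phi(\{u,v\})$. For finite $A\subseteq\mathcal{V}$, a point $\omega$ and $\alpha\in V^A$ such that $\alpha\,\omega|_{A^c}\in\mathrm{Hom}(\mathcal{G},H)$, let $$E^\Phi_{A,\omega}(\alpha)=\sum_{x\in A}\Big(\Phi(\alpha(x))+\tfrac12\sum_{y\in A:\,y\sim x}\Phi(\alpha(x),\alpha(y))+\sum_{y\in\partial A:\,y\sim x}\Phi(\alpha(x),\omega(y))\Big).$$ Let $\pi^\omega_A$ be the probability measure on $V^A$ with $\pi^\omega_A(\alpha)$ proportional to $e^{-E^\Phi_{A,\omega}(\alpha)}$ if $\alpha\,\omega|_{A^c}\in\mathrm{Hom}(\mathcal{G},H)$, and $0$ otherwise; $\pi^\omega_A(\beta)=\sum_{\alpha:\alpha|_B=\beta}\pi^\omega_A(\alpha)$ for $\beta\in V^B$, $B\subseteq A$. The Gibbs $(\mathcal{G},H,\Phi)$-specification is $\pi=\{\pi^\omega_A\}$ over finite $A$ and points $\omega$. It satisfies exponential strong spatial mixing (SSM) with decay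 rate $\gamma>0$ if there is $C>0$ such that for all finite $A$, $B\subseteq A$, $\beta\in V^B$ and points $\omega_1,\omega_2$, $|\pi^{\omega_1}_A(\beta)-\pi^{\omega_2}_A(\beta)|\le|B|\,Ce^{-\gamma\,\mathrm{dist}(B,\Sigma_{\partial A}(\omega_1,\omega_2))}$. *)

theory Defs
  imports "HOL-Analysis.Analysis" "HOL-Library.Infinite_Typeclass"
begin

section \<open>Undirected graphs, loops allowed\<close>

text \<open>An edge is a one- or two-element set of vertices; the edge \<open>{v} = {v, v}\<close> is a loop at \<open>v\<close>.\<close>

record 'a ugraph =
  verts :: "'a set"
  edges :: "'a set set"

definition ugraph :: "'a ugraph \<Rightarrow> bool" where
  "ugraph G \<longleftrightarrow> (\<forall>e\<in>edges G. \<exists>u\<in>verts G. \<exists>v\<in>verts G. e = {u, v})"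

definition adj :: "'a ugraph \<Rightarrow> 'a \<Rightarrow> 'a \<Rightarrow> bool" where
  "adj G u v \<longleftrightarrow> {u, v} \<in> edges G"

definition walk :: "'a ugraph \<Rightarrow> 'a list \<Rightarrow> bool" where
  "walk G p \<longleftrightarrow> p \<noteq> [] \<and> set p \<subseteq> verts G \<and> successively (adj G) p"

definition connected_graph :: "'a ugraph \<Rightarrow> bool" where
  "connected_graph G \<longleftrightarrow>
     (\<forall>u\<in>verts G. \<forall>v\<in>verts G. \<exists>p. walk G p \<and> hd p = u \<and> last p = v)"

text \<open>A cycle is given by its distinct vertices in cyclic order. Length 1 is a loop; length 2 is
  excluded, since it would only traverse one edge back and forth.\<close>

definition cycle :: "'a ugraph \<Rightarrow> 'a list \<Rightarrow> bool" where
  "cycle G c \<longleftrightarrow> walk G c \<and> distinct c \<and> length c \<noteq> 2 \<and> adj G (last c) (hd c)"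

definition tree :: "'a ugraph \<Rightarrow> bool" where
  "tree G \<longleftrightarrow> ugraph G \<and> connected_graph G \<and> (\<nexists>c. cycle G c)"

definition looped_tree :: "'a ugraph \<Rightarrow> bool" where
  "looped_tree G \<longleftrightarrow> (\<exists>T L. tree T \<and> L \<subseteq> verts T \<and>
     G = \<lparr>verts = verts T, edges = edges T \<union> {{v} | v. v \<in> L}\<rparr>)"

definition board :: "'v ugraph \<Rightarrow> bool" where
  "board G \<longleftrightarrow> ugraph G \<and> countable (verts G) \<and> (\<forall>v. \<not> adj G v v) \<and> connected_graph G \<and>
     (\<forall>v\<in>verts G. finite {w. adj G v w}) \<and> (\<exists>u\<in>verts G. \<exists>v\<in>verts G. u \<noteq> v)"

definition Z2 :: "(int \<times> int) ugraph" where
  "Z2 = \<lparr>verts = UNIV,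
     edges = {{x, y} | x y. \<bar>fst x - fst y\<bar> + \<bar>snd x - snd y\<bar> = 1}\<rparr>"

text \<open>Distances are extended naturals, so that the distance to the empty set is \<open>\<infinity>\<close>.\<close>

definition gdist :: "'v ugraph \<Rightarrow> 'v \<Rightarrow> 'v \<Rightarrow> enat" where
  "gdist G x y = (INF p\<in>{p. walk G p \<and> hd p = x \<and> last p = y}. enat (length p - 1))"

definition gsetdist :: "'v ugraph \<Rightarrow> 'v set \<Rightarrow> 'v set \<Rightarrow> enat" where
  "gsetdist G A B = (INF x\<in>A. INF y\<in>B. gdist G x y)"

definition boundary :: "'v ugraph \<Rightarrow> 'v set \<Rightarrow> 'v set" where
  "boundary G A = {x \<in> verts G. gsetdist G {x} A = 1}"


section \<open>Homomorphism spaces and TSSM\<close>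

text \<open>Configurations in \<open>V\<^sup>A\<close> are extensional functions \<open>A \<rightarrow>\<^sub>E V\<close>; the concatenation of \<open>\<alpha>\<close> on \<open>A\<close>
  and \<open>\<beta>\<close> on \<open>B\<close> is \<open>merge A B (\<alpha>, \<beta>)\<close>.\<close>

definition Hom :: "'v ugraph \<Rightarrow> 'a ugraph \<Rightarrow> ('v \<Rightarrow> 'a) set" where
  "Hom G H = {\<omega> \<in> verts G \<rightarrow>\<^sub>E verts H. \<forall>x y. adj G x y \<longrightarrow> adj H (\<omega> x) (\<omega> y)}"

definition globally_admissible ::
    "'v ugraph \<Rightarrow> 'a ugraph \<Rightarrow> 'v set \<Rightarrow> ('v \<Rightarrow> 'a) \<Rightarrow> bool" where
  "globally_admissible G H A \<alpha> \<longleftrightarrow> (\<exists>\<omega>\<in>Hom G H. \<alpha> = restrict \<omega> A)"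

definition TSSM :: "'v ugraph \<Rightarrow> 'a ugraph \<Rightarrow> bool" where
  "TSSM G H \<longleftrightarrow> (\<exists>g::nat. \<forall>A B S.
     finite A \<and> finite B \<and> finite S \<and> A \<subseteq> verts G \<and> B \<subseteq> verts G \<and> S \<subseteq> verts G \<and>
     A \<inter> B = {} \<and> A \<inter> S = {} \<and> B \<inter> S = {} \<and> gsetdist G A B \<ge> enat g \<longrightarrow>
     (\<forall>\<alpha>\<in>A \<rightarrow>\<^sub>E verts H. \<forall>\<beta>\<in>B \<rightarrow>\<^sub>E verts H. \<forall>\<sigma>\<in>S \<rightarrow>\<^sub>E verts H.
        globally_admissible G H (A \<union> S) (merge A S (\<alpha>, \<sigma>)) \<and>
        globally_admissible G H (S \<union> B) (merge S B (\<sigma>, \<beta>)) \<longrightarrow>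
        globally_admissible G H (A \<union> S \<union> B)
          (merge (A \<union> S) B (merge A S (\<alpha>, \<sigma>), \<beta>))))"


section \<open>Gibbs specifications and exponential SSM\<close>

text \<open>An interaction is a function on the disjoint union \<open>V <+> E\<close>, so that the value at a vertex
  \<open>v\<close> is independent of the value at the loop \<open>{v}\<close>.\<close>

definition nn_interaction :: "'a ugraph \<Rightarrow> ('a + 'a set \<Rightarrow> real) \<Rightarrow> bool" where
  "nn_interaction H \<Phi> \<longleftrightarrow> \<Phi> \<in> (verts H <+> edges H) \<rightarrow> {..0}"

definition energy ::
    "'v ugraph \<Rightarrow> ('a + 'a set \<Rightarrow> real) \<Rightarrow> 'v set \<Rightarrow> ('v \<Rightarrow> 'a) \<Rightarrow> ('v \<Rightarrow> 'a) \<Rightarrow> real" where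
  "energy G \<Phi> A \<omega> \<alpha> = (\<Sum>x\<in>A. \<Phi> (Inl (\<alpha> x))
     + (1/2) * (\<Sum>y | y \<in> A \<and> adj G y x. \<Phi> (Inr {\<alpha> x, \<alpha> y}))
     + (\<Sum>y | y \<in> boundary G A \<and> adj G y x. \<Phi> (Inr {\<alpha> x, \<omega> y})))"

definition compatible ::
    "'v ugraph \<Rightarrow> 'a ugraph \<Rightarrow> 'v set \<Rightarrow> ('v \<Rightarrow> 'a) \<Rightarrow> ('v \<Rightarrow> 'a) set" where
  "compatible G H A \<omega> =
     {\<alpha> \<in> A \<rightarrow>\<^sub>E verts H. merge A (verts G - A) (\<alpha>, \<omega>) \<in> Hom G H}"

definition gibbs ::
    "'v ugraph \<Rightarrow> 'a ugraph \<Rightarrow> ('a + 'a set \<Rightarrow> real) \<Rightarrow> 'v set \<Rightarrow> ('v \<Rightarrow> 'a) \<Rightarrow> ('v \<Rightarrow> 'a) \<Rightarrow> real" where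
  "gibbs G H \<Phi> A \<omega> \<alpha> =
     (if \<alpha> \<in> compatible G H A \<omega>
      then exp (- energy G \<Phi> A \<omega> \<alpha>) / (\<Sum>\<alpha>'\<in>compatible G H A \<omega>. exp (- energy G \<Phi> A \<omega> \<alpha>'))
      else 0)"

definition gibbs_marginal ::
    "'v ugraph \<Rightarrow> 'a ugraph \<Rightarrow> ('a + 'a set \<Rightarrow> real) \<Rightarrow> 'v set \<Rightarrow> ('v \<Rightarrow> 'a) \<Rightarrow>
     'v set \<Rightarrow> ('v \<Rightarrow> 'a) \<Rightarrow> real" where
  "gibbs_marginal G H \<Phi> A \<omega> B \<beta> =
     (\<Sum>\<alpha> | \<alpha> \<in> A \<rightarrow>\<^sub>E verts H \<and> restrict \<alpha> B = \<beta>. gibbs G H \<Phi> A \<omega> \<alpha>)"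

definition disagreement :: "'v set \<Rightarrow> ('v \<Rightarrow> 'a) \<Rightarrow> ('v \<Rightarrow> 'a) \<Rightarrow> 'v set" where
  "disagreement B \<alpha>\<^sub>1 \<alpha>\<^sub>2 = {x \<in> B. \<alpha>\<^sub>1 x \<noteq> \<alpha>\<^sub>2 x}"

definition exp_decay :: "real \<Rightarrow> real \<Rightarrow> enat \<Rightarrow> real" where
  "exp_decay C \<gamma> d = (case d of enat n \<Rightarrow> C * exp (- \<gamma> * real n) | \<infinity> \<Rightarrow> 0)"

definition exp_SSM ::
    "'v ugraph \<Rightarrow> 'a ugraph \<Rightarrow> ('a + 'a set \<Rightarrow> real) \<Rightarrow> real \<Rightarrow> bool" where
  "exp_SSM G H \<Phi> \<gamma> \<longleftrightarrow> (\<exists>C>0. \<forall>A B. finite A \<and> A \<subseteq> verts G \<and> B \<subseteq> A \<longrightarrow>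
     (\<forall>\<beta>\<in>B \<rightarrow>\<^sub>E verts H. \<forall>\<omega>\<^sub>1\<in>Hom G H. \<forall>\<omega>\<^sub>2\<in>Hom G H.
        \<bar>gibbs_marginal G H \<Phi> A \<omega>\<^sub>1 B \<beta> - gibbs_marginal G H \<Phi> A \<omega>\<^sub>2 B \<beta>\<bar>
        \<le> real (card B) *
           exp_decay C \<gamma> (gsetdist G B (disagreement (boundary G A) \<omega>\<^sub>1 \<omega>\<^sub>2))))"

end

theory Submission
  imports Defs
begin

text \<open>
  All three statements hold if and only if the looped vertices of \<open>T\<close> form a nonempty connected set, or
  \<open>T\<close> has no edge and there are no points at all.

  Suppose first that the looped vertices are nonempty and connected, and root \<open>T\<close> at one of them
  (\<open>loop_rooted_tree\<close>). A point that is known on \<open>S\<close> has a shallowest extension, whose values are all as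
  close to the root as \<open>S\<close> permits (\<open>shallowest_Hom\<close>); where the vertices without loops could obstruct
  this, a parity argument shows that they do not. A vertex of \<open>S\<close> affects this extension only up to a
  distance that is the height of \<open>T\<close> (\<open>shallowest_local\<close>). Splicing two shallowest extensions gives TSSM
  on every board (\<open>TSSM_of_loop_rooted\<close>).

  For the Gibbs measures, take vertex interactions that strongly favour small depth. Replacing the
  values near \<open>U\<close> by a shallowest extension shows that leaving the shallowest extension of the boundary
  condition on all of \<open>U\<close> has probability at most \<open>\<epsilon> ^ card U\<close>, for \<open>\<epsilon>\<close> as small as desired (\<open>peierls\<close>). Now
  take independent configurations for two boundary conditions. If no path of disagreement leads from \<open>B\<close>
  to the disagreement of the boundary conditions, exchanging the configurations off the cluster of
  disagreement is a symmetry that interchanges their restrictions to \<open>B\<close> (\<open>marginal_diff_le\<close>). Otherwise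
  one of the configurations leaves its shallowest extension at each vertex of a long path, and summing
  over paths gives exponential decay at any prescribed rate (\<open>exp_SSM_of_loop_rooted\<close>).

  Suppose now that the looped vertices are not connected, or that \<open>T\<close> has an edge but no loop. Then on
  \<open>\<int>\<^sup>2\<close> there are boundary conditions that differ only far away from a vertex \<open>z\<close> and yet have no common
  value at \<open>z\<close> (\<open>long_range_rigid\<close>). Without loops this is the parity of a bipartite graph
  (\<open>rigid_of_no_loops\<close>); if there is a gap between two looped vertices, a strip of the right width in
  which a point has to cross the gap in every column transports one bit of information
  (\<open>rigid_of_loop_gap\<close>). Such rigidity contradicts TSSM and also SSM for every interaction.
\<close>

section \<open>Walks, distances and boundaries\<close>

lemma adj_commute: "adj G x y \<longleftrightarrow> adj G y x"
  by (simp add: adj_def insert_commute)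

lemma adj_in_verts:
  assumes "ugraph G" "adj G x y"
  shows "x \<in> verts G" "y \<in> verts G"
  using assms unfolding ugraph_def adj_def by (fastforce simp: doubleton_eq_iff)+

lemma relpowp_adj_in_verts:
  assumes "ugraph G" "(adj G ^^ n) x y" "x \<in> verts G"
  shows "y \<in> verts G"
  using assms by (cases n) (auto dest: adj_in_verts)

lemma relpowp_adj_commute: "(adj G ^^ n) x y \<Longrightarrow> (adj G ^^ n) y x"
proof (induction n arbitrary: y)
  case (Suc n)
  then obtain z where "(adj G ^^ n) x z" "adj G z y" by auto
  then show ?case using Suc.IH by (intro relpowp_Suc_I2) (auto simp: adj_commute)
qed auto

lemma relpowp_trans: "(R ^^ m) x y \<Longrightarrow> (R ^^ n) y z \<Longrightarrow> (R ^^ (m + n)) x z"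
  by (auto simp: relpowp_add)

text \<open>Walks of length \<open>n\<close> are handled as powers of the adjacency relation; the next lemmas
  turn the distances of the definitions into such powers.\<close>

lemma relpowp_adj_iff_walk:
  assumes "ugraph G" "x \<in> verts G"
  shows "(adj G ^^ n) x y \<longleftrightarrow> (\<exists>p. walk G p \<and> hd p = x \<and> last p = y \<and> length p = Suc n)"
proof (induction n arbitrary: y)
  case 0
  show ?case
    using assms(2) by (auto simp: length_Suc_conv walk_def intro!: exI[of _ "[x]"])
next
  case (Suc n)
  show ?case
  proof
    assume "(adj G ^^ Suc n) x y"
    then obtain z where z: "(adj G ^^ n) x z" "adj G z y" by auto
    then obtain p where p: "walk G p" "hd p = x" "last p = z" "length p = Suc n"
      using Suc by blast
    have "walk G (p @ [y])"
      using p z adj_in_verts[OF assms(1) z(2)] by (auto simp: walk_def successively_append_iff)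
    then show "\<exists>p. walk G p \<and> hd p = x \<and> last p = y \<and> length p = Suc (Suc n)"
      using p by (intro exI[of _ "p @ [y]"]) (auto simp: walk_def)
  next
    assume "\<exists>p. walk G p \<and> hd p = x \<and> last p = y \<and> length p = Suc (Suc n)"
    then obtain p where p: "walk G p" "hd p = x" "last p = y" "length p = Suc (Suc n)" by blast
    then obtain q where q: "p = q @ [y]" "length q = Suc n"
      by (metis append_butlast_last_id length_append_singleton nat.inject walk_def)
    then have "q \<noteq> []" by auto
    with p q have "walk G q" "hd q = x" "adj G (last q) y"
      by (auto simp: walk_def successively_append_iff)
    with Suc q have "(adj G ^^ n) x (last q)" by blast
    then show "(adj G ^^ Suc n) x y" using \<open>adj G (last q) y\<close> by auto
  qed
qed

lemma gdist_less_iff: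
  assumes "ugraph G" "x \<in> verts G"
  shows "gdist G x y < enat n \<longleftrightarrow> (\<exists>k<n. (adj G ^^ k) x y)"
proof -
  have "gdist G x y < enat n \<longleftrightarrow>
      (\<exists>p. walk G p \<and> hd p = x \<and> last p = y \<and> length p - 1 < n)"
    by (auto simp: gdist_def INF_less_iff)
  also have "\<dots> \<longleftrightarrow> (\<exists>k<n. \<exists>p. walk G p \<and> hd p = x \<and> last p = y \<and> length p = Suc k)"
    by (auto simp: walk_def) (metis Suc_pred length_greater_0_conv)
  finally show ?thesis by (simp add: relpowp_adj_iff_walk[OF assms])
qed

lemma gsetdist_less_iff:
  assumes "ugraph G" "A \<subseteq> verts G"
  shows "gsetdist G A B < enat n \<longleftrightarrow> (\<exists>a\<in>A. \<exists>b\<in>B. \<exists>k<n. (adj G ^^ k) a b)"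
  unfolding gsetdist_def INF_less_iff using assms gdist_less_iff by (metis subsetD)

lemma gsetdist_ge_iff:
  assumes "ugraph G" "A \<subseteq> verts G"
  shows "enat n \<le> gsetdist G A B \<longleftrightarrow> (\<forall>a\<in>A. \<forall>b\<in>B. \<forall>k. (adj G ^^ k) a b \<longrightarrow> n \<le> k)"
  using gsetdist_less_iff[OF assms, of B n] by (metis not_le)

lemma mem_boundary_iff:
  assumes "ugraph G" "A \<subseteq> verts G"
  shows "x \<in> boundary G A \<longleftrightarrow> x \<notin> A \<and> (\<exists>a\<in>A. adj G x a)"
proof (cases "x \<in> verts G")
  case True
  then have s: "{x} \<subseteq> verts G" by simp
  have "gsetdist G {x} A = 1 \<longleftrightarrow> \<not> gsetdist G {x} A < enat 1 \<and> gsetdist G {x} A < enat 2"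
  proof (cases "gsetdist G {x} A")
    case (enat n)
    then show ?thesis by (auto simp: one_enat_def)
  qed auto
  also have "\<dots> \<longleftrightarrow> x \<notin> A \<and> (\<exists>a\<in>A. adj G x a)"
    unfolding gsetdist_less_iff[OF assms(1) s] less_2_cases_iff
    by (auto simp: ex_disj_distrib conj_disj_distribR)
  finally show ?thesis using True by (simp add: boundary_def)
next
  case False
  then show ?thesis using adj_in_verts[OF assms(1)] by (auto simp: boundary_def)
qed

lemma finite_boundary:
  assumes "ugraph G" "A \<subseteq> verts G" "finite A" "\<And>v. v \<in> verts G \<Longrightarrow> finite {w. adj G v w}"
  shows "finite (boundary G A)"
proof -
  have "boundary G A \<subseteq> (\<Union>a\<in>A. {w. adj G a w})"
    using mem_boundary_iff[OF assms(1,2)] by (auto simp: adj_commute)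
  moreover have "finite (\<Union>a\<in>A. {w. adj G a w})" using assms by blast
  ultimately show ?thesis using finite_subset by blast
qed

section \<open>Points\<close>

lemma HomI:
  assumes "\<And>x. x \<in> verts G \<Longrightarrow> \<omega> x \<in> verts H" "\<And>x. x \<notin> verts G \<Longrightarrow> \<omega> x = undefined"
    "\<And>x y. adj G x y \<Longrightarrow> adj H (\<omega> x) (\<omega> y)"
  shows "\<omega> \<in> Hom G H"
  using assms by (auto simp: Hom_def PiE_def extensional_def)

lemma Hom_in_verts: "\<omega> \<in> Hom G H \<Longrightarrow> x \<in> verts G \<Longrightarrow> \<omega> x \<in> verts H"
  and Hom_undefined: "\<omega> \<in> Hom G H \<Longrightarrow> x \<notin> verts G \<Longrightarrow> \<omega> x = undefined"
  and Hom_adj: "\<omega> \<in> Hom G H \<Longrightarrow> adj G x y \<Longrightarrow> adj H (\<omega> x) (\<omega> y)"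
  by (auto simp: Hom_def)

text \<open>Globally admissible configurations are restrictions of points, so TSSM can be stated about points
  alone: two points that agree on \<open>S\<close> can be spliced.\<close>

lemma TSSM_iff_points:
  "TSSM G H \<longleftrightarrow> (\<exists>g::nat. \<forall>A B S.
     finite A \<and> finite B \<and> finite S \<and> A \<subseteq> verts G \<and> B \<subseteq> verts G \<and> S \<subseteq> verts G \<and>
     A \<inter> B = {} \<and> A \<inter> S = {} \<and> B \<inter> S = {} \<and> gsetdist G A B \<ge> enat g \<longrightarrow>
     (\<forall>\<omega>\<^sub>1\<in>Hom G H. \<forall>\<omega>\<^sub>2\<in>Hom G H. (\<forall>x\<in>S. \<omega>\<^sub>1 x = \<omega>\<^sub>2 x) \<longrightarrow>
       (\<exists>\<omega>\<in>Hom G H. (\<forall>x\<in>A \<union> S. \<omega> x = \<omega>\<^sub>1 x) \<and> (\<forall>x\<in>B. \<omega> x = \<omega>\<^sub>2 x))))"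
proof -
  have "(\<forall>\<alpha>\<in>A \<rightarrow>\<^sub>E verts H. \<forall>\<beta>\<in>B \<rightarrow>\<^sub>E verts H. \<forall>\<sigma>\<in>S \<rightarrow>\<^sub>E verts H.
        globally_admissible G H (A \<union> S) (merge A S (\<alpha>, \<sigma>)) \<and>
        globally_admissible G H (S \<union> B) (merge S B (\<sigma>, \<beta>)) \<longrightarrow>
        globally_admissible G H (A \<union> S \<union> B)
          (merge (A \<union> S) B (merge A S (\<alpha>, \<sigma>), \<beta>))) \<longleftrightarrow>
     (\<forall>\<omega>\<^sub>1\<in>Hom G H. \<forall>\<omega>\<^sub>2\<in>Hom G H. (\<forall>x\<in>S. \<omega>\<^sub>1 x = \<omega>\<^sub>2 x) \<longrightarrow>
       (\<exists>\<omega>\<in>Hom G H. (\<forall>x\<in>A \<union> S. \<omega> x = \<omega>\<^sub>1 x) \<and> (\<forall>x\<in>B. \<omega> x = \<omega>\<^sub>2 x)))"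
    (is "?L \<longleftrightarrow> ?R")
    if sub: "A \<subseteq> verts G" "B \<subseteq> verts G" "S \<subseteq> verts G"
      and disj: "A \<inter> B = {}" "A \<inter> S = {}" "B \<inter> S = {}" for A B S
  proof
    assume L: ?L
    show ?R
    proof (intro ballI impI)
      fix \<omega>1 \<omega>2 assume w: "\<omega>1 \<in> Hom G H" "\<omega>2 \<in> Hom G H" and eq: "\<forall>x\<in>S. \<omega>1 x = \<omega>2 x"
      have r: "restrict \<omega>1 A \<in> A \<rightarrow>\<^sub>E verts H" "restrict \<omega>2 B \<in> B \<rightarrow>\<^sub>E verts H"
        "restrict \<omega>1 S \<in> S \<rightarrow>\<^sub>E verts H"
        using Hom_in_verts[OF w(1)] Hom_in_verts[OF w(2)] sub by auto
      have m: "merge A S (restrict \<omega>1 A, restrict \<omega>1 S) = restrict \<omega>1 (A \<union> S)"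
        "merge S B (restrict \<omega>1 S, restrict \<omega>2 B) = restrict \<omega>2 (S \<union> B)"
        using eq by (auto simp: merge_def fun_eq_iff)
      have "globally_admissible G H (A \<union> S) (merge A S (restrict \<omega>1 A, restrict \<omega>1 S))"
        "globally_admissible G H (S \<union> B) (merge S B (restrict \<omega>1 S, restrict \<omega>2 B))"
        unfolding m globally_admissible_def using w by blast+
      then have "globally_admissible G H (A \<union> S \<union> B)
          (merge (A \<union> S) B (merge A S (restrict \<omega>1 A, restrict \<omega>1 S), restrict \<omega>2 B))"
        using L[rule_format, OF r] by blast
      then obtain \<omega> where \<omega>: "\<omega> \<in> Hom G H"
        "merge (A \<union> S) B (merge A S (restrict \<omega>1 A, restrict \<omega>1 S), restrict \<omega>2 B) =
         restrict \<omega> (A \<union> S \<union> B)"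
        unfolding globally_admissible_def by blast
      have "\<omega> x = \<omega>1 x" if "x \<in> A \<union> S" for x
        using fun_cong[OF \<omega>(2), of x] that by (auto simp: merge_def split: if_splits)
      moreover have "\<omega> x = \<omega>2 x" if "x \<in> B" for x
        using fun_cong[OF \<omega>(2), of x] that disj by (auto simp: merge_def split: if_splits)
      ultimately show "\<exists>\<omega>\<in>Hom G H. (\<forall>x\<in>A \<union> S. \<omega> x = \<omega>1 x) \<and> (\<forall>x\<in>B. \<omega> x = \<omega>2 x)"
        using \<omega>(1) by blast
    qed
  next
    assume R: ?R
    show ?L
    proof (intro ballI impI, elim conjE)
      fix \<alpha> \<beta> \<sigma> assume "globally_admissible G H (A \<union> S) (merge A S (\<alpha>, \<sigma>))"
        "globally_admissible G H (S \<union> B) (merge S B (\<sigma>, \<beta>))"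
      then obtain \<omega>1 \<omega>2 where w: "\<omega>1 \<in> Hom G H" "\<omega>2 \<in> Hom G H"
        and 1: "merge A S (\<alpha>, \<sigma>) = restrict \<omega>1 (A \<union> S)"
        and 2: "merge S B (\<sigma>, \<beta>) = restrict \<omega>2 (S \<union> B)"
        unfolding globally_admissible_def by blast
      have v: "\<alpha> x = \<omega>1 x" if "x \<in> A" for x
        using fun_cong[OF 1, of x] that by (auto simp: merge_def)
      have v1: "\<sigma> x = \<omega>1 x" if "x \<in> S" for x
        using fun_cong[OF 1, of x] that disj by (auto simp: merge_def split: if_splits)
      have v2: "\<sigma> x = \<omega>2 x" if "x \<in> S" for x
        using fun_cong[OF 2, of x] that by (auto simp: merge_def)
      have v3: "\<beta> x = \<omega>2 x" if "x \<in> B" for x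
        using fun_cong[OF 2, of x] that disj by (auto simp: merge_def split: if_splits)
      obtain \<omega> where "\<omega> \<in> Hom G H" "\<forall>x\<in>A \<union> S. \<omega> x = \<omega>1 x" "\<forall>x\<in>B. \<omega> x = \<omega>2 x"
        using R[rule_format, OF w] v1 v2 by auto
      then show "globally_admissible G H (A \<union> S \<union> B)
          (merge (A \<union> S) B (merge A S (\<alpha>, \<sigma>), \<beta>))"
        unfolding globally_admissible_def
        by (intro bexI[of _ \<omega>]) (auto simp: merge_def fun_eq_iff v v1 v3)
    qed
  qed
  note * = this
  show ?thesis
    unfolding TSSM_def
    by (intro iff_exI iff_allI imp_cong refl, elim conjE, rule *; assumption)
qed

section \<open>Rooted looped trees and shallowest extensions\<close>

text \<open>Rooting makes the adjacency of a looped tree local: apart from loops, a vertex is adjacent exactly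
  to its parent and its children. The root is its own parent, so that \<open>par ^^ n\<close> saturates at the root.\<close>

locale rooted_tree =
  fixes H :: "'a ugraph" and r :: 'a and par :: "'a \<Rightarrow> 'a" and dep :: "'a \<Rightarrow> nat"
  assumes ugraph_H: "ugraph H"
    and finite_verts: "finite (verts H)"
    and root_in_verts: "r \<in> verts H"
    and par_in_verts: "v \<in> verts H \<Longrightarrow> par v \<in> verts H"
    and dep_par: "v \<in> verts H \<Longrightarrow> dep (par v) = dep v - 1"
    and dep_eq_0_iff: "v \<in> verts H \<Longrightarrow> dep v = 0 \<longleftrightarrow> v = r"
    and adj_iff_par: "u \<in> verts H \<Longrightarrow> v \<in> verts H \<Longrightarrow> u \<noteq> v \<Longrightarrow>
           adj H u v \<longleftrightarrow> u = par v \<or> v = par u"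
begin

definition anc :: "'a \<Rightarrow> 'a \<Rightarrow> bool" where
  "anc u v \<longleftrightarrow> (\<exists>k. u = (par ^^ k) v)"

definition height :: nat where
  "height = Max (dep ` verts H)"

lemma dep_le_height: "v \<in> verts H \<Longrightarrow> dep v \<le> height"
  unfolding height_def using finite_verts by simp

lemma par_pow_in_verts: "v \<in> verts H \<Longrightarrow> (par ^^ k) v \<in> verts H"
  by (induction k) (auto intro: par_in_verts)

lemma dep_par_pow: "v \<in> verts H \<Longrightarrow> dep ((par ^^ k) v) = dep v - k"
  by (induction k) (auto simp: dep_par par_pow_in_verts)

lemma dep_root [simp]: "dep r = 0"
  using dep_eq_0_iff root_in_verts by simp

lemma par_pow_eq_root_iff: "v \<in> verts H \<Longrightarrow> (par ^^ k) v = r \<longleftrightarrow> dep v \<le> k"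
  using dep_eq_0_iff[OF par_pow_in_verts, of v k] dep_par_pow[of v k] by simp

lemma anc_refl: "anc v v"
  unfolding anc_def by (rule exI[of _ 0]) simp

lemma anc_trans: "anc u v \<Longrightarrow> anc v w \<Longrightarrow> anc u w"
  unfolding anc_def by (metis comp_apply funpow_add)

lemma anc_par: "anc (par v) v"
  unfolding anc_def by (rule exI[of _ 1]) simp

lemma anc_par_mono: "anc u v \<Longrightarrow> anc (par u) (par v)"
  unfolding anc_def by (metis funpow_swap1)

lemma anc_eqI:
  assumes "anc u w" "anc v w" "w \<in> verts H" "dep u = dep v"
  shows "u = v"
proof -
  obtain k l where k: "u = (par ^^ k) w" and l: "v = (par ^^ l) w"
    using assms by (auto simp: anc_def)
  show ?thesis
  proof (cases "k = l")
    case False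
    then have "dep u = 0" "dep v = 0" using assms k l dep_par_pow by auto
    then show ?thesis using dep_eq_0_iff par_pow_in_verts assms(3) k l by metis
  qed (use k l in simp)
qed

lemma anc_in_verts: "anc u v \<Longrightarrow> v \<in> verts H \<Longrightarrow> u \<in> verts H"
  using par_pow_in_verts by (auto simp: anc_def)

lemma anc_dep_le: "anc u v \<Longrightarrow> v \<in> verts H \<Longrightarrow> dep u \<le> dep v"
  by (auto simp: anc_def dep_par_pow)

lemma anc_root: "v \<in> verts H \<Longrightarrow> anc r v"
  unfolding anc_def by (metis order_refl par_pow_eq_root_iff)

lemma adj_in_vertsH: "adj H u v \<Longrightarrow> u \<in> verts H" "adj H u v \<Longrightarrow> v \<in> verts H"
  using adj_in_verts[OF ugraph_H] by blast+

lemma adj_cases: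
  assumes "adj H u v"
  obtains "u = v" | "u \<noteq> v" "u = par v" "dep v = Suc (dep u)"
    | "u \<noteq> v" "v = par u" "dep u = Suc (dep v)"
proof (cases "u = v")
  case False
  have uv: "u \<in> verts H" "v \<in> verts H" using adj_in_vertsH assms by auto
  have *: "dep b = Suc (dep (par b))" if "b \<in> verts H" "par b \<noteq> b" for b
  proof -
    have "dep b \<noteq> 0"
    proof
      assume "dep b = 0"
      then have "b = r" "dep (par b) = 0" using that dep_eq_0_iff dep_par by auto
      then show False using that dep_eq_0_iff par_in_verts by metis
    qed
    then show ?thesis using dep_par that by simp
  qed
  show ?thesis using adj_iff_par[OF uv False] assms * uv False that by metis
qed (use that in blast)

lemma anc_par_adj: "adj H u v \<Longrightarrow> anc (par u) v"
  by (erule adj_cases) (auto simp: anc_refl intro: anc_par anc_trans)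

text \<open>In one step of a walk the value of a point can move up the tree by at most one level, so after
  \<open>n\<close> steps it is still below the \<open>n\<close>-th ancestor of the value where the walk started.\<close>

lemma anc_par_pow_walk:
  assumes "\<omega> \<in> Hom G H" "(adj G ^^ n) s x"
  shows "anc ((par ^^ n) (\<omega> s)) (\<omega> x)"
  using assms(2)
proof (induction n arbitrary: x)
  case 0
  then show ?case by (auto simp: anc_refl)
next
  case (Suc n)
  then obtain y where y: "(adj G ^^ n) s y" "adj G y x" by auto
  have "anc (par ((par ^^ n) (\<omega> s))) (par (\<omega> y))" using Suc.IH[OF y(1)] by (rule anc_par_mono)
  then show ?case using anc_par_adj[OF Hom_adj[OF assms(1) y(2)]] anc_trans by auto
qed

end

text \<open>As \<open>par\<close> leads every vertex to the root, the assumptions say that the looped vertices form a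
  connected set around the root.\<close>

locale loop_rooted_tree = rooted_tree +
  assumes loop_root: "adj H r r"
    and loop_par: "adj H v v \<Longrightarrow> adj H (par v) (par v)"
begin

lemma loop_anc: "anc u v \<Longrightarrow> adj H v v \<Longrightarrow> adj H u u"
proof -
  have "adj H ((par ^^ k) v) ((par ^^ k) v)" if "adj H v v" for k
    using that by (induction k) (auto intro: loop_par)
  then show "anc u v \<Longrightarrow> adj H v v \<Longrightarrow> adj H u u" by (auto simp: anc_def)
qed

text \<open>Suppose that a point is only known on \<open>S\<close>, where it equals \<open>\<omega>\<close>. By \<open>anc_par_pow_walk\<close> every value in
  \<open>candidates G S \<omega> x\<close> is an ancestor of whatever stands at \<open>x\<close>; hence they lie on one branch, and the
  deepest of them is the value closest to the root that \<open>S\<close> can permit at \<open>x\<close>.\<close>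

definition candidates :: "'v ugraph \<Rightarrow> 'v set \<Rightarrow> ('v \<Rightarrow> 'a) \<Rightarrow> 'v \<Rightarrow> 'a set" where
  "candidates G S \<omega> x = insert r {(par ^^ n) (\<omega> s) | s n. s \<in> S \<and> (adj G ^^ n) s x}"

definition shallowest :: "'v ugraph \<Rightarrow> 'v set \<Rightarrow> ('v \<Rightarrow> 'a) \<Rightarrow> 'v \<Rightarrow> 'a" where
  "shallowest G S \<omega> = (\<lambda>x\<in>verts G. ARG_MAX dep v. v \<in> candidates G S \<omega> x)"

context
  fixes G :: "'v ugraph" and \<omega> :: "'v \<Rightarrow> 'a" and S :: "'v set"
  assumes G: "ugraph G" and \<omega>: "\<omega> \<in> Hom G H"
begin

lemma candidates_anc:
  assumes "x \<in> verts G" "v \<in> candidates G S \<omega> x"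
  shows "anc v (\<omega> x)"
  using assms anc_par_pow_walk[OF \<omega>] anc_root Hom_in_verts[OF \<omega>]
  by (auto simp: candidates_def)

lemma shallowest_mem:
  assumes "x \<in> verts G"
  shows "shallowest G S \<omega> x \<in> candidates G S \<omega> x"
    and "v \<in> candidates G S \<omega> x \<Longrightarrow> dep v \<le> dep (shallowest G S \<omega> x)"
proof -
  have "r \<in> candidates G S \<omega> x" by (simp add: candidates_def)
  moreover have "\<forall>v. v \<in> candidates G S \<omega> x \<longrightarrow> dep v < Suc (dep (\<omega> x))"
    using candidates_anc[OF assms] anc_dep_le Hom_in_verts[OF \<omega> assms] by fastforce
  ultimately have "(ARG_MAX dep v. v \<in> candidates G S \<omega> x) \<in> candidates G S \<omega> x \<and>
      (\<forall>v. v \<in> candidates G S \<omega> x \<longrightarrow> dep v \<le> dep (ARG_MAX dep v. v \<in> candidates G S \<omega> x))"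
    by (rule arg_max_nat_lemma)
  then show "shallowest G S \<omega> x \<in> candidates G S \<omega> x"
    "v \<in> candidates G S \<omega> x \<Longrightarrow> dep v \<le> dep (shallowest G S \<omega> x)"
    using assms by (auto simp: shallowest_def)
qed

lemma shallowest_anc: "x \<in> verts G \<Longrightarrow> anc (shallowest G S \<omega> x) (\<omega> x)"
  using candidates_anc shallowest_mem by blast

lemma shallowest_on:
  assumes "x \<in> S" "x \<in> verts G"
  shows "shallowest G S \<omega> x = \<omega> x"
proof -
  have "\<omega> x \<in> candidates G S \<omega> x"
    using assms unfolding candidates_def by (intro insertI2 CollectI exI[of _ x] exI[of _ 0]) auto
  then have "dep (\<omega> x) \<le> dep (shallowest G S \<omega> x)" using shallowest_mem assms by blast
  moreover have "dep (shallowest G S \<omega> x) \<le> dep (\<omega> x)"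
    using anc_dep_le shallowest_anc Hom_in_verts[OF \<omega>] assms by blast
  ultimately show ?thesis
    using anc_eqI[OF shallowest_anc anc_refl] assms Hom_in_verts[OF \<omega>] by simp
qed

text \<open>Outside the looped vertices the tree is bipartite. If even the \<open>n\<close>-th ancestor of \<open>\<omega> s\<close> has no
  loop, then a walk of length \<open>n\<close> from \<open>s\<close> stays in that bipartite part and its length fixes the parity
  of the depth.\<close>

lemma dep_parity_walk:
  assumes "(adj G ^^ n) s x" "\<not> adj H ((par ^^ n) (\<omega> s)) ((par ^^ n) (\<omega> s))"
  shows "even (dep (\<omega> x)) \<longleftrightarrow> even (dep (\<omega> s) + n)"
  using assms
proof (induction n arbitrary: x)
  case (Suc n)
  then obtain y where y: "(adj G ^^ n) s y" "adj G y x" by auto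
  have "\<not> adj H ((par ^^ n) (\<omega> s)) ((par ^^ n) (\<omega> s))"
    using Suc.prems(2) loop_par by auto
  then have IH: "even (dep (\<omega> y)) \<longleftrightarrow> even (dep (\<omega> s) + n)" using Suc.IH y by blast
  have "anc ((par ^^ Suc n) (\<omega> s)) (\<omega> x)" by (rule anc_par_pow_walk[OF \<omega> Suc.prems(1)])
  then have "\<not> adj H (\<omega> x) (\<omega> x)" using loop_anc Suc.prems(2) by blast
  then have "even (dep (\<omega> x)) \<longleftrightarrow> odd (dep (\<omega> y))"
    by - (rule adj_cases[OF Hom_adj[OF \<omega> y(2)]]; use adj_commute Hom_adj[OF \<omega> y(2)] in auto)
  then show ?case using IH by simp
qed auto

text \<open>The two values are comparable and differ by at most one level, because candidates can be passed
  on to a neighbour by moving up once. So they are adjacent unless they coincide at a vertex without a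
  loop; but then the parity of the depth, which \<open>\<omega>\<close> shares with its shallowest extension there, would
  be the same at the neighbours \<open>x\<close> and \<open>y\<close>.\<close>

lemma shallowest_adj:
  assumes xy: "adj G x y"
  shows "adj H (shallowest G S \<omega> x) (shallowest G S \<omega> y)"
proof -
  let ?m = "shallowest G S \<omega>"
  have v: "x \<in> verts G" "y \<in> verts G" using adj_in_verts[OF G xy] by auto
  have step: "dep (?m a) - 1 \<le> dep (?m b)" if "adj G a b" for a b
  proof -
    have ab: "a \<in> verts G" "b \<in> verts G" using adj_in_verts[OF G that] by auto
    have "par (?m a) \<in> candidates G S \<omega> b"
    proof -
      have "par r = r" using par_pow_eq_root_iff[OF root_in_verts, of 1] by simp
      moreover have "(par ^^ Suc n) (\<omega> s) \<in> candidates G S \<omega> b" if "s \<in> S" "(adj G ^^ n) s a" for s n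
        using that \<open>adj G a b\<close> unfolding candidates_def
        by (intro insertI2 CollectI exI[of _ s] exI[of _ "Suc n"]) auto
      moreover consider "?m a = r" | s n where "?m a = (par ^^ n) (\<omega> s)" "s \<in> S" "(adj G ^^ n) s a"
        using shallowest_mem(1)[OF ab(1)] unfolding candidates_def by blast
      ultimately show ?thesis
        by cases (simp add: candidates_def, metis comp_apply funpow.simps(2))
    qed
    then show ?thesis
      using shallowest_mem[OF ab(2)] dep_par anc_in_verts[OF shallowest_anc Hom_in_verts[OF \<omega>]] ab
      by metis
  qed
  have a: "adj H (\<omega> x) (\<omega> y)" using \<omega> xy by (rule Hom_adj)
  have verts: "?m x \<in> verts H" "?m y \<in> verts H"
    using v anc_in_verts[OF shallowest_anc Hom_in_verts[OF \<omega>]] by auto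
  obtain w where w: "anc (?m x) w" "anc (?m y) w" "w \<in> verts H"
    using a adj_in_vertsH[OF a] shallowest_anc[OF v(1)] shallowest_anc[OF v(2)] anc_par anc_trans
    by (metis adj_cases)
  have d: "dep (?m x) - 1 \<le> dep (?m y)" "dep (?m y) - 1 \<le> dep (?m x)"
    using step xy by (auto simp: adj_commute)
  have par_case: "p = par q" if "anc p w" "anc q w" "dep p = dep q - 1" "q \<in> verts H" for p q
  proof -
    have "anc (par q) w" using anc_par anc_trans that by blast
    then show ?thesis using anc_eqI[OF that(1) _ w(3)] dep_par that by simp
  qed
  show ?thesis
  proof (cases "?m x = ?m y")
    case False
    then have "dep (?m x) \<noteq> dep (?m y)" using anc_eqI w by blast
    then have "dep (?m x) = dep (?m y) - 1 \<or> dep (?m y) = dep (?m x) - 1" using d by linarith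
    then show ?thesis using par_case w verts adj_iff_par[OF verts False] by metis
  next
    case True
    show ?thesis
    proof (rule ccontr)
      assume "\<not> ?thesis"
      with True have nl: "\<not> adj H (?m x) (?m x)" "\<not> adj H (?m y) (?m y)" by auto
      have par: "even (dep (\<omega> z)) \<longleftrightarrow> even (dep (?m z))"
        if z: "z \<in> verts G" "\<not> adj H (?m z) (?m z)" for z
      proof -
        have "?m z \<noteq> r" using z(2) loop_root by auto
        then obtain s n where s: "s \<in> S" "(adj G ^^ n) s z" "?m z = (par ^^ n) (\<omega> s)"
          using shallowest_mem(1)[OF z(1)] by (auto simp: candidates_def)
        have "s \<in> verts G"
          using relpowp_adj_in_verts[OF G relpowp_adj_commute[OF s(2)] z(1)] .
        then have "\<omega> s \<in> verts H" using Hom_in_verts[OF \<omega>] by blast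
        then have "dep (?m z) = dep (\<omega> s) - n" "n < dep (\<omega> s)"
          using s(3) \<open>?m z \<noteq> r\<close> dep_par_pow par_pow_eq_root_iff by (auto simp: not_le[symmetric])
        then show ?thesis using dep_parity_walk[OF s(2)] z(2) s(3) by auto
      qed
      have "\<not> adj H (\<omega> x) (\<omega> x)" using loop_anc[OF shallowest_anc[OF v(1)]] nl by blast
      then have "even (dep (\<omega> x)) \<longleftrightarrow> odd (dep (\<omega> y))"
        using a by - (rule adj_cases[OF a]; auto)
      then show False using par[OF v(1)] par[OF v(2)] nl True by simp
    qed
  qed
qed

lemma shallowest_Hom: "shallowest G S \<omega> \<in> Hom G H"
proof (rule HomI)
  show "shallowest G S \<omega> x \<in> verts H" if "x \<in> verts G" for x
    using anc_in_verts[OF shallowest_anc Hom_in_verts[OF \<omega>]] that by blast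
  show "shallowest G S \<omega> x = undefined" if "x \<notin> verts G" for x
    using that by (simp add: shallowest_def)
qed (rule shallowest_adj)

end

text \<open>From distance \<open>height\<close> on, a vertex of \<open>S\<close> contributes only the root. Shallowest extensions are
  therefore local.\<close>

lemma candidates_far:
  assumes "ugraph G" "\<omega> \<in> Hom G H" "x \<in> verts G"
  shows "candidates G S \<omega> x =
    insert r {(par ^^ n) (\<omega> s) | s n. s \<in> S \<and> n < height \<and> (adj G ^^ n) s x}"
proof -
  have "(par ^^ n) (\<omega> s) = r" if "(adj G ^^ n) s x" "height \<le> n" for s n
  proof -
    have "s \<in> verts G"
      using relpowp_adj_in_verts[OF assms(1) relpowp_adj_commute[OF that(1)] assms(3)] .
    then have "\<omega> s \<in> verts H" using Hom_in_verts[OF assms(2)] by blast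
    then show ?thesis using par_pow_eq_root_iff dep_le_height that(2) le_trans by metis
  qed
  then show ?thesis unfolding candidates_def by (auto simp: not_le[symmetric])
qed

lemma shallowest_local:
  assumes "ugraph G" "\<omega> \<in> Hom G H" "\<omega>' \<in> Hom G H"
    and "\<And>s n. (adj G ^^ n) s x \<Longrightarrow> n < height \<Longrightarrow> (s \<in> S \<longleftrightarrow> s \<in> S') \<and> (s \<in> S \<longrightarrow> \<omega> s = \<omega>' s)"
  shows "shallowest G S \<omega> x = shallowest G S' \<omega>' x"
proof (cases "x \<in> verts G")
  case True
  have "candidates G S \<omega> x = candidates G S' \<omega>' x"
    unfolding candidates_far[OF assms(1,2) True] candidates_far[OF assms(1,3) True]
    using assms(4) by (intro arg_cong[of _ _ "insert r"] Collect_cong) metis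
  then show ?thesis by (simp add: shallowest_def)
qed (simp add: shallowest_def)

text \<open>The shallowest extension from \<open>A \<union> S\<close> is used near \<open>A\<close> and the one from \<open>S \<union> B\<close> elsewhere. If
  one end of an edge is near \<open>A\<close> and the other is not, then the distance \<open>2 * height + 1\<close> keeps both ends
  out of the reach of \<open>B\<close>, so at the other end the two extensions coincide.\<close>

lemma TSSM_of_loop_rooted:
  assumes "ugraph G"
  shows "TSSM G H"
  unfolding TSSM_iff_points
proof (intro exI[of _ "2 * height + 1"] allI impI ballI, elim conjE)
  fix A B S :: "'b set" and \<omega>1 \<omega>2
  assume sub: "A \<subseteq> verts G" "B \<subseteq> verts G" "S \<subseteq> verts G"
    and dist: "enat (2 * height + 1) \<le> gsetdist G A B"
    and w: "\<omega>1 \<in> Hom G H" "\<omega>2 \<in> Hom G H" and eq: "\<forall>x\<in>S. \<omega>1 x = \<omega>2 x"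
  define near where "near x \<longleftrightarrow> (\<exists>a\<in>A. \<exists>n<height. (adj G ^^ n) a x)" for x
  define m1 where "m1 = shallowest G (A \<union> S) \<omega>1"
  define m2 where "m2 = shallowest G (S \<union> B) \<omega>2"
  define \<omega> where "\<omega> x = (if near x then m1 x else m2 x)" for x
  have m: "m1 \<in> Hom G H" "m2 \<in> Hom G H"
    unfolding m1_def m2_def using shallowest_Hom assms w by auto
  have far: "2 * height + 1 \<le> n" if "a \<in> A" "b \<in> B" "(adj G ^^ n) a b" for a b n
    using dist gsetdist_ge_iff[OF assms sub(1)] that by blast
  have off: "m1 x = m2 x" if "\<not> near x" "\<And>b n. b \<in> B \<Longrightarrow> (adj G ^^ n) b x \<Longrightarrow> height \<le> n" for x
    unfolding m1_def m2_def
  proof (rule shallowest_local[OF assms w])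
    fix s n assume "(adj G ^^ n) s x" "n < height"
    then have "s \<notin> A" "s \<notin> B" using that unfolding near_def by (auto simp: not_le[symmetric])
    then show "(s \<in> A \<union> S \<longleftrightarrow> s \<in> S \<union> B) \<and> (s \<in> A \<union> S \<longrightarrow> \<omega>1 s = \<omega>2 s)" using eq by auto
  qed
  have adj: "adj H (\<omega> x) (\<omega> y)" if xy: "adj G x y" "near x" for x y
  proof -
    obtain a n where a: "a \<in> A" "n < height" "(adj G ^^ n) a x" using xy near_def by blast
    then have ay: "(adj G ^^ Suc n) a y" using xy by auto
    have "height \<le> k" if "b \<in> B" "(adj G ^^ k) b y" for b k
      using far[OF a(1) that(1) relpowp_trans[OF ay relpowp_adj_commute[OF that(2)]]] a(2) by simp
    then have "\<omega> y = m1 y" using off[of y] unfolding \<omega>_def by auto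
    moreover have "\<omega> x = m1 x" using xy(2) unfolding \<omega>_def by simp
    ultimately show ?thesis using Hom_adj[OF m(1) xy(1)] by simp
  qed
  have "\<omega> \<in> Hom G H"
  proof (rule HomI)
    show "\<omega> x \<in> verts H" if "x \<in> verts G" for x using m Hom_in_verts that unfolding \<omega>_def by auto
    show "\<omega> x = undefined" if "x \<notin> verts G" for x using m Hom_undefined that unfolding \<omega>_def by auto
    show "adj H (\<omega> x) (\<omega> y)" if "adj G x y" for x y
    proof (cases "near x \<or> near y")
      case True
      then show ?thesis using adj[of x y] adj[of y x] that by (auto simp: adj_commute)
    next
      case False
      then show ?thesis using Hom_adj[OF m(2) that] unfolding \<omega>_def by simp
    qed
  qed
  moreover have "\<omega> x = \<omega>1 x" if "x \<in> A \<union> S" for x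
  proof -
    have 1: "m1 x = \<omega>1 x" unfolding m1_def
      using shallowest_on[OF assms w(1)] that sub by blast
    have 2: "x \<in> S \<Longrightarrow> m2 x = \<omega>2 x" unfolding m2_def
      using shallowest_on[OF assms w(2)] sub by blast
    show ?thesis
    proof (cases "x \<in> S")
      case True
      then show ?thesis using 1 2 eq unfolding \<omega>_def by auto
    next
      case False
      then have x: "x \<in> A" using that by blast
      have "m1 x = m2 x" if "\<not> near x"
      proof (rule off[OF that])
        fix b n assume "b \<in> B" "(adj G ^^ n) b x"
        then show "height \<le> n" using far[OF x _ relpowp_adj_commute] by fastforce
      qed
      then show ?thesis using 1 unfolding \<omega>_def by auto
    qed
  qed
  moreover have "\<omega> x = \<omega>2 x" if "x \<in> B" for x
  proof -
    have "\<not> near x"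
    proof
      assume "near x"
      then obtain a n where "a \<in> A" "n < height" "(adj G ^^ n) a x" using near_def by blast
      then show False using far[of a x n] that by simp
    qed
    moreover have "m2 x = \<omega>2 x" unfolding m2_def
      using shallowest_on[OF assms w(2)] sub that by blast
    ultimately show ?thesis unfolding \<omega>_def by simp
  qed
  ultimately show "\<exists>\<omega>\<in>Hom G H. (\<forall>x\<in>A \<union> S. \<omega> x = \<omega>1 x) \<and> (\<forall>x\<in>B. \<omega> x = \<omega>2 x)" by blast
qed

end

section \<open>Counting\<close>

definition degree_bound :: "'v ugraph \<Rightarrow> nat \<Rightarrow> bool" where
  "degree_bound G \<Delta> \<longleftrightarrow> (\<forall>v\<in>verts G. finite {w. adj G v w} \<and> card {w. adj G v w} \<le> \<Delta>)"

lemma card_sphere_le: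
  assumes "ugraph G" "x \<in> verts G"
    and deg: "degree_bound G \<Delta>"
  shows "finite {y. (adj G ^^ n) x y} \<and> card {y. (adj G ^^ n) x y} \<le> \<Delta> ^ n"
proof (induction n)
  case (Suc n)
  have eq: "{y. (adj G ^^ Suc n) x y} = (\<Union>z\<in>{z. (adj G ^^ n) x z}. {w. adj G z w})"
    by auto
  have v: "z \<in> verts G" if "(adj G ^^ n) x z" for z
    using relpowp_adj_in_verts[OF assms(1) that assms(2)] .
  have "card (\<Union>z\<in>{z. (adj G ^^ n) x z}. {w. adj G z w}) \<le> (\<Sum>z\<in>{z. (adj G ^^ n) x z}. card {w. adj G z w})"
    using Suc by (intro card_UN_le) auto
  also have "\<dots> \<le> (\<Sum>z\<in>{z. (adj G ^^ n) x z}. \<Delta>)"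
    using v deg by (intro sum_mono) (auto simp: degree_bound_def)
  also have "\<dots> \<le> \<Delta> ^ Suc n" using Suc by simp
  finally show ?case unfolding eq using Suc v deg by (auto simp: degree_bound_def)
qed auto

lemma card_walks_le:
  assumes "ugraph G" "x \<in> verts G"
    and deg: "degree_bound G \<Delta>"
  shows "finite {p. length p = n \<and> successively (adj G) (x # p)} \<and>
         card {p. length p = n \<and> successively (adj G) (x # p)} \<le> \<Delta> ^ n"
  using assms(2)
proof (induction n arbitrary: x)
  case 0
  have "{p. length p = 0 \<and> successively (adj G) (x # p)} = {[]}" by auto
  then show ?case by simp
next
  case (Suc n)
  let ?P = "\<lambda>x. {p. length p = n \<and> successively (adj G) (x # p)}"
  have eq: "{p. length p = Suc n \<and> successively (adj G) (x # p)} =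
      (\<Union>w\<in>{w. adj G x w}. (#) w ` ?P w)"
    by (auto simp: length_Suc_conv image_iff)
  have v: "w \<in> verts G" if "adj G x w" for w using adj_in_verts(2)[OF assms(1) that] .
  have "card (\<Union>w\<in>{w. adj G x w}. (#) w ` ?P w) \<le> (\<Sum>w\<in>{w. adj G x w}. card ((#) w ` ?P w))"
    using deg Suc.prems by (intro card_UN_le) (auto simp: degree_bound_def)
  also have "\<dots> \<le> (\<Sum>w\<in>{w. adj G x w}. \<Delta> ^ n)"
    using Suc.IH v by (intro sum_mono) (auto simp: card_image)
  also have "\<dots> \<le> \<Delta> ^ Suc n" using deg Suc.prems by (simp add: degree_bound_def)
  finally show ?case unfolding eq using Suc deg v by (auto simp: degree_bound_def)
qed

text \<open>The counting step of a Peierls argument: a map that gains weight and is not too far from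
  injective bounds the weight of its domain.\<close>

lemma sum_le_fibres:
  fixes w :: "'b \<Rightarrow> real"
  assumes "finite E" "finite C" "F ` E \<subseteq> C" "\<And>\<alpha>. 0 \<le> w \<alpha>" "0 \<le> c"
    and le: "\<And>\<alpha>. \<alpha> \<in> E \<Longrightarrow> w \<alpha> \<le> c * w (F \<alpha>)"
    and fib: "\<And>\<beta>. real (card {\<alpha> \<in> E. F \<alpha> = \<beta>}) \<le> K"
  shows "sum w E \<le> K * c * sum w C"
proof -
  have K: "0 \<le> K" using fib[of undefined] by (rule order_trans[rotated]) simp
  have "sum w E \<le> (\<Sum>\<alpha>\<in>E. c * w (F \<alpha>))" by (intro sum_mono le)
  also have "\<dots> = (\<Sum>\<beta>\<in>F ` E. \<Sum>\<alpha> | \<alpha> \<in> E \<and> F \<alpha> = \<beta>. c * w (F \<alpha>))"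
    by (rule sum.image_gen[OF assms(1)])
  also have "\<dots> = (\<Sum>\<beta>\<in>F ` E. real (card {\<alpha> \<in> E. F \<alpha> = \<beta>}) * (c * w \<beta>))"
    by (intro sum.cong refl) simp
  also have "\<dots> \<le> (\<Sum>\<beta>\<in>F ` E. K * (c * w \<beta>))"
    using assms(4,5) by (intro sum_mono mult_right_mono fib) auto
  also have "\<dots> \<le> (\<Sum>\<beta>\<in>C. K * (c * w \<beta>))"
    using assms K by (intro sum_mono2) auto
  finally show ?thesis by (simp add: sum_distrib_left mult.assoc)
qed

lemma sum_le_cover:
  fixes w :: "'b \<Rightarrow> real"
  assumes "finite I" "\<And>i. i \<in> I \<Longrightarrow> finite (S i)" "\<And>x. 0 \<le> w x" "X \<subseteq> (\<Union>i\<in>I. S i)"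
    and le: "\<And>i. i \<in> I \<Longrightarrow> sum w (S i) \<le> c"
  shows "sum w X \<le> real (card I) * c"
proof -
  have "sum w X \<le> sum w (\<Union>i\<in>I. S i)" using assms by (intro sum_mono2) auto
  also have "\<dots> \<le> (\<Sum>i\<in>I. sum w (S i))"
    using assms(1,2)
  proof (induction I rule: finite_induct)
    case (insert i I)
    have "sum w (S i \<union> (\<Union>i\<in>I. S i)) \<le> sum w (S i) + sum w (\<Union>i\<in>I. S i)"
      using insert assms(3) by (subst sum.union_inter[symmetric]) (auto intro!: sum_nonneg)
    then show ?case using insert by simp
  qed simp
  also have "\<dots> \<le> (\<Sum>i\<in>I. c)" by (intro sum_mono le)
  finally show ?thesis by simp
qed

section \<open>Compatible configurations\<close>

lemma compatible_iff:
  assumes "\<omega> \<in> Hom G H" "A \<subseteq> verts G"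
  shows "\<alpha> \<in> compatible G H A \<omega> \<longleftrightarrow> \<alpha> \<in> extensional A \<and> override_on \<omega> \<alpha> A \<in> Hom G H"
proof -
  have eq: "merge A (verts G - A) (\<alpha>, \<omega>) = override_on \<omega> \<alpha> A" for \<alpha>
    using Hom_undefined[OF assms(1)] assms(2) by (auto simp: merge_def override_on_def fun_eq_iff)
  have "\<alpha> x \<in> verts H" if "override_on \<omega> \<alpha> A \<in> Hom G H" "x \<in> A" for x
    using Hom_in_verts[OF that(1), of x] that(2) assms(2) by (auto simp: override_on_def)
  then show ?thesis unfolding compatible_def by (auto simp: PiE_def eq)
qed

lemma finite_compatible: "finite A \<Longrightarrow> finite (verts H) \<Longrightarrow> finite (compatible G H A \<omega>)"
  by (rule finite_subset[of _ "A \<rightarrow>\<^sub>E verts H"]) (auto simp: compatible_def intro: finite_PiE)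

lemma override_on_Hom:
  assumes "ugraph G" "A \<subseteq> verts G" "\<omega> \<in> Hom G H" "f \<in> Hom G H"
    and "\<And>x. x \<in> boundary G A \<Longrightarrow> f x = \<omega> x"
  shows "override_on \<omega> f A \<in> Hom G H"
proof (rule HomI)
  fix x y assume xy: "adj G x y"
  have "x \<in> A \<Longrightarrow> y \<notin> A \<Longrightarrow> f y = \<omega> y" "y \<in> A \<Longrightarrow> x \<notin> A \<Longrightarrow> f x = \<omega> x"
    using assms(5) mem_boundary_iff[OF assms(1,2)] xy adj_commute by metis+
  then show "adj H (override_on \<omega> f A x) (override_on \<omega> f A y)"
    using Hom_adj[OF assms(3) xy] Hom_adj[OF assms(4) xy] by (auto simp: override_on_def)
next
  fix x
  show "override_on \<omega> f A x \<in> verts H" if "x \<in> verts G"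
    using Hom_in_verts[OF assms(3) that] Hom_in_verts[OF assms(4) that] by (simp add: override_on_def)
  show "override_on \<omega> f A x = undefined" if "x \<notin> verts G"
    using Hom_undefined[OF assms(3) that] that assms(2) by (auto simp: override_on_def)
qed

lemma restrict_compatible:
  assumes "ugraph G" "A \<subseteq> verts G" "\<omega> \<in> Hom G H" "f \<in> Hom G H"
    and "\<And>x. x \<in> boundary G A \<Longrightarrow> f x = \<omega> x"
  shows "restrict f A \<in> compatible G H A \<omega>"
proof -
  have "override_on \<omega> (restrict f A) A = override_on \<omega> f A"
    by (auto simp: override_on_def fun_eq_iff)
  then show ?thesis using override_on_Hom[OF assms] compatible_iff[OF assms(3,2)] by simp
qed

section \<open>A Peierls bound\<close>

context loop_rooted_tree
begin

text \<open>The interaction rewards proximity to the root and ignores edges. The energy then does not see the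
  boundary condition, so the weights of two configurations are preserved when their values are
  exchanged on any set of vertices.\<close>

definition weight :: "real \<Rightarrow> 'v set \<Rightarrow> ('v \<Rightarrow> 'a) \<Rightarrow> real" where
  "weight L A \<alpha> = exp (L * (\<Sum>x\<in>A. real (height - dep (\<alpha> x))))"

definition root_interaction :: "real \<Rightarrow> 'a + 'a set \<Rightarrow> real" where
  "root_interaction L = case_sum (\<lambda>v. - L * real (height - dep v)) (\<lambda>_. 0)"

lemma nn_interaction_root: "0 \<le> L \<Longrightarrow> nn_interaction H (root_interaction L)"
  by (auto simp: nn_interaction_def root_interaction_def)

lemma exp_energy: "exp (- energy G (root_interaction L) A \<omega> \<alpha>) = weight L A \<alpha>"
  by (simp add: energy_def root_interaction_def weight_def sum_distrib_left sum_negf[symmetric])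

lemma weight_pos: "0 < weight L A \<alpha>" and weight_nonneg: "0 \<le> weight L A \<alpha>"
  by (auto simp: weight_def)

definition partition_sum :: "'v ugraph \<Rightarrow> real \<Rightarrow> 'v set \<Rightarrow> ('v \<Rightarrow> 'a) \<Rightarrow> real" where
  "partition_sum G L A \<omega> = (\<Sum>\<alpha>\<in>compatible G H A \<omega>. weight L A \<alpha>)"

lemma partition_sum_pos:
  assumes "ugraph G" "finite A" "A \<subseteq> verts G" "\<omega> \<in> Hom G H"
  shows "0 < partition_sum G L A \<omega>"
  unfolding partition_sum_def
  using restrict_compatible[OF assms(1,3,4,4)] finite_compatible[OF assms(2) finite_verts]
  by (intro sum_pos) (auto simp: weight_pos)

lemma gibbs_marginal_root:
  assumes "finite A"
  shows "gibbs_marginal G H (root_interaction L) A \<omega> B \<beta> =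
    (\<Sum>\<alpha> | \<alpha> \<in> compatible G H A \<omega> \<and> restrict \<alpha> B = \<beta>. weight L A \<alpha>) / partition_sum G L A \<omega>"
proof -
  have "gibbs_marginal G H (root_interaction L) A \<omega> B \<beta> =
    (\<Sum>\<alpha> | \<alpha> \<in> compatible G H A \<omega> \<and> restrict \<alpha> B = \<beta>. weight L A \<alpha> / partition_sum G L A \<omega>)"
    unfolding gibbs_marginal_def
  proof (rule sum.mono_neutral_cong_right)
    show "finite {\<alpha> \<in> A \<rightarrow>\<^sub>E verts H. restrict \<alpha> B = \<beta>}"
      using finite_PiE[OF assms, of "\<lambda>_. verts H"] finite_verts by simp
  qed (auto simp: gibbs_def compatible_def exp_energy partition_sum_def)
  then show ?thesis by (simp add: sum_divide_distrib)
qed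

context
  fixes G :: "'v ugraph" and \<Delta> :: nat and A :: "'v set"
  assumes G: "ugraph G"
    and deg: "degree_bound G \<Delta>"
    and A: "finite A" "A \<subseteq> verts G"
begin

definition ball_bound :: nat where
  "ball_bound = (\<Sum>n<height. \<Delta> ^ n)"

lemma card_neighbourhood_le:
  assumes "U \<subseteq> A"
  shows "card {y \<in> A. \<exists>x\<in>U. \<exists>n<height. (adj G ^^ n) x y} \<le> ball_bound * card U"
proof -
  have U: "finite U" "U \<subseteq> verts G" using finite_subset[OF assms A(1)] assms A(2) by auto
  have fin: "finite {y. (adj G ^^ n) x y}" "card {y. (adj G ^^ n) x y} \<le> \<Delta> ^ n" if "x \<in> U" for x n
    using card_sphere_le[OF G subsetD[OF U(2) that] deg] by auto
  have "{y \<in> A. \<exists>x\<in>U. \<exists>n<height. (adj G ^^ n) x y} \<subseteq> (\<Union>x\<in>U. \<Union>n<height. {y. (adj G ^^ n) x y})"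
    by auto
  then have "card {y \<in> A. \<exists>x\<in>U. \<exists>n<height. (adj G ^^ n) x y} \<le>
      card (\<Union>x\<in>U. \<Union>n<height. {y. (adj G ^^ n) x y})"
    using U fin by (intro card_mono) auto
  also have "\<dots> \<le> (\<Sum>x\<in>U. card (\<Union>n<height. {y. (adj G ^^ n) x y}))"
    using U by (intro card_UN_le)
  also have "\<dots> \<le> (\<Sum>x\<in>U. \<Sum>n<height. card {y. (adj G ^^ n) x y})"
    by (intro sum_mono card_UN_le) auto
  also have "\<dots> \<le> (\<Sum>x\<in>U. ball_bound)"
    unfolding ball_bound_def using fin by (intro sum_mono) auto
  finally show ?thesis by (simp add: mult.commute)
qed

text \<open>A configuration that differs from the shallowest extension \<open>m\<close> of the boundary condition on all of
  \<open>U\<close> is changed within distance \<open>height\<close> of \<open>U\<close> only: it is replaced by the shallowest extension of its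
  restriction to the other vertices. This never moves a value away from the root, it moves every value
  on \<open>U\<close> at least one level up, to \<open>m\<close>, and at most \<open>card (verts H) ^ (ball_bound * card U)\<close> configurations
  have the same image.\<close>

lemma peierls:
  assumes \<omega>: "\<omega> \<in> Hom G H" and U: "U \<subseteq> A" and L: "0 \<le> L"
  shows "(\<Sum>\<alpha> | \<alpha> \<in> compatible G H A \<omega> \<and> (\<forall>x\<in>U. \<alpha> x \<noteq> shallowest G (boundary G A) \<omega> x). weight L A \<alpha>)
    \<le> (real (card (verts H)) ^ ball_bound * exp (- L)) ^ card U * partition_sum G L A \<omega>"
proof -
  let ?m = "shallowest G (boundary G A) \<omega>"
  define N where "N = {y \<in> A. \<exists>x\<in>U. \<exists>n<height. (adj G ^^ n) x y}"
  define E where "E = {\<alpha> \<in> compatible G H A \<omega>. \<forall>x\<in>U. \<alpha> x \<noteq> ?m x}"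
  define g where "g \<alpha> = shallowest G (boundary G A \<union> (A - N)) (override_on \<omega> \<alpha> A)" for \<alpha>
  define F where "F \<alpha> = restrict (g \<alpha>) A" for \<alpha>
  have bd: "x \<notin> A" if "x \<in> boundary G A" for x using mem_boundary_iff[OF G A(2)] that by blast
  have bdv: "x \<in> verts G" if "x \<in> boundary G A" for x using that by (simp add: boundary_def)
  have f: "override_on \<omega> \<alpha> A \<in> Hom G H" if "\<alpha> \<in> compatible G H A \<omega>" for \<alpha>
    using compatible_iff[OF \<omega> A(2)] that by blast
  have gH: "g \<alpha> \<in> Hom G H" if "\<alpha> \<in> compatible G H A \<omega>" for \<alpha>
    unfolding g_def by (rule shallowest_Hom[OF G f[OF that]])
  have gb: "g \<alpha> x = \<omega> x" if "\<alpha> \<in> compatible G H A \<omega>" "x \<in> boundary G A" for \<alpha> x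
    using shallowest_on[OF G f[OF that(1)], of x] that(2) bd bdv by (simp add: g_def)
  have gN: "g \<alpha> x = \<alpha> x" if "\<alpha> \<in> compatible G H A \<omega>" "x \<in> A - N" for \<alpha> x
    using shallowest_on[OF G f[OF that(1)], of x] that(2) A(2) by (auto simp: g_def)
  have gU: "g \<alpha> x = ?m x" if "\<alpha> \<in> compatible G H A \<omega>" "x \<in> U" for \<alpha> x
    unfolding g_def
  proof (rule shallowest_local[OF G f[OF that(1)] \<omega>])
    fix s n assume "(adj G ^^ n) s x" "n < height"
    then have "s \<notin> A - N" using relpowp_adj_commute that(2) unfolding N_def by fastforce
    then show "(s \<in> boundary G A \<union> (A - N) \<longleftrightarrow> s \<in> boundary G A) \<and>
        (s \<in> boundary G A \<union> (A - N) \<longrightarrow> override_on \<omega> \<alpha> A s = \<omega> s)"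
      using bd by auto
  qed
  have anc: "anc (g \<alpha> x) (\<alpha> x)" if "\<alpha> \<in> compatible G H A \<omega>" "x \<in> A" for \<alpha> x
    using shallowest_anc[OF G f[OF that(1)], of x] that(2) A(2) by (auto simp: g_def)
  have \<alpha>H: "\<alpha> x \<in> verts H" if "\<alpha> \<in> compatible G H A \<omega>" "x \<in> A" for \<alpha> x
    using that by (auto simp: compatible_def)
  have "F ` E \<subseteq> compatible G H A \<omega>"
    unfolding F_def E_def using restrict_compatible[OF G A(2) \<omega> gH] gb by auto
  moreover have "weight L A \<alpha> \<le> exp (- L) ^ card U * weight L A (F \<alpha>)" if "\<alpha> \<in> E" for \<alpha>
  proof -
    have c: "\<alpha> \<in> compatible G H A \<omega>" using that by (simp add: E_def)
    have "(\<Sum>x\<in>A. real (height - dep (\<alpha> x)) + of_bool (x \<in> U)) \<le> (\<Sum>x\<in>A. real (height - dep (F \<alpha> x)))"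
    proof (rule sum_mono)
      fix x assume x: "x \<in> A"
      have le: "dep (g \<alpha> x) \<le> dep (\<alpha> x)" using anc_dep_le anc c x \<alpha>H by blast
      have "dep (g \<alpha> x) < dep (\<alpha> x)" if "x \<in> U"
      proof -
        have "g \<alpha> x \<noteq> \<alpha> x" using gU[OF c that] \<open>\<alpha> \<in> E\<close> that by (auto simp: E_def)
        then show ?thesis using anc_eqI[OF anc[OF c x] anc_refl \<alpha>H[OF c x]] le by linarith
      qed
      moreover have "dep (\<alpha> x) \<le> height" using dep_le_height \<alpha>H c x by blast
      ultimately show "real (height - dep (\<alpha> x)) + of_bool (x \<in> U) \<le> real (height - dep (F \<alpha> x))"
        using le x by (auto simp: F_def)
    qed
    moreover have "(\<Sum>x\<in>A. real (of_bool (x \<in> U))) = real (card U)"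
      using U A(1) by (simp add: Int_absorb1)
    ultimately have "(\<Sum>x\<in>A. real (height - dep (\<alpha> x))) + real (card U) \<le> (\<Sum>x\<in>A. real (height - dep (F \<alpha> x)))"
      by (simp add: sum.distrib)
    then have "L * (\<Sum>x\<in>A. real (height - dep (\<alpha> x))) \<le>
        - L * real (card U) + L * (\<Sum>x\<in>A. real (height - dep (F \<alpha> x)))"
      using mult_left_mono[OF _ L] by (fastforce simp: algebra_simps)
    then show ?thesis unfolding weight_def
      by (simp add: exp_of_nat_mult[symmetric] exp_add[symmetric] mult.commute)
  qed
  moreover have "real (card {\<alpha> \<in> E. F \<alpha> = \<beta>}) \<le> (real (card (verts H)) ^ ball_bound) ^ card U" for \<beta>
  proof -
    have finN: "finite N" using A(1) by (simp add: N_def)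
    \<comment> \<open>The image of a configuration retains its values off \<open>N\<close>.\<close>
    have "inj_on (\<lambda>\<alpha>. restrict \<alpha> N) {\<alpha> \<in> E. F \<alpha> = \<beta>}"
    proof (rule inj_onI)
      fix a b assume ab: "a \<in> {\<alpha> \<in> E. F \<alpha> = \<beta>}" "b \<in> {\<alpha> \<in> E. F \<alpha> = \<beta>}"
        and eq: "restrict a N = restrict b N"
      then have c: "a \<in> compatible G H A \<omega>" "b \<in> compatible G H A \<omega>" and F: "F a = F b"
        by (auto simp: E_def)
      have "a x = b x" for x
      proof -
        consider "x \<notin> A" | "x \<in> N" | "x \<in> A - N" by blast
        then show ?thesis
        proof cases
          case 1
          then show ?thesis using c by (auto simp: compatible_def PiE_def extensional_def)
        next
          case 2
          then show ?thesis using fun_cong[OF eq, of x] by simp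
        next
          case 3
          then show ?thesis using gN[OF c(1), of x] gN[OF c(2), of x] fun_cong[OF F, of x]
            by (simp add: F_def)
        qed
      qed
      then show "a = b" by blast
    qed
    moreover have "(\<lambda>\<alpha>. restrict \<alpha> N) ` {\<alpha> \<in> E. F \<alpha> = \<beta>} \<subseteq> N \<rightarrow>\<^sub>E verts H"
    proof -
      have "N \<subseteq> A" by (auto simp: N_def)
      then show ?thesis using \<alpha>H by (auto simp: E_def)
    qed
    moreover have "finite (N \<rightarrow>\<^sub>E verts H)" using finite_PiE[OF finN, of "\<lambda>_. verts H"] finite_verts by simp
    ultimately have "card {\<alpha> \<in> E. F \<alpha> = \<beta>} \<le> card (N \<rightarrow>\<^sub>E verts H)"
      by (rule card_inj_on_le)
    also have "\<dots> = card (verts H) ^ card N" by (simp add: card_PiE[OF finN])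
    also have "\<dots> \<le> card (verts H) ^ (ball_bound * card U)"
      using card_neighbourhood_le[OF U] finite_verts root_in_verts unfolding N_def
      by (intro power_increasing) (auto simp: Suc_le_eq card_gt_0_iff)
    finally have "card {\<alpha> \<in> E. F \<alpha> = \<beta>} \<le> (card (verts H) ^ ball_bound) ^ card U"
      by (simp add: power_mult)
    then show ?thesis using of_nat_mono by fastforce
  qed
  ultimately have "sum (weight L A) E \<le>
      (real (card (verts H)) ^ ball_bound) ^ card U * exp (- L) ^ card U *
      sum (weight L A) (compatible G H A \<omega>)"
    using finite_compatible[OF A(1) finite_verts]
    by (intro sum_le_fibres[where F = F]) (auto simp: E_def weight_nonneg)
  then show ?thesis by (simp add: E_def partition_sum_def power_mult_distrib)
qed

end

end

section \<open>Swapping two independent configurations\<close>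

text \<open>The part of \<open>A\<close> that is joined to \<open>D\<close> by a path of disagreement between \<open>a\<close> and \<open>b\<close>. Here \<open>D\<close> is
  where the two boundary conditions differ.\<close>

definition cluster ::
    "'v ugraph \<Rightarrow> 'v set \<Rightarrow> 'v set \<Rightarrow> ('v \<Rightarrow> 'a) \<Rightarrow> ('v \<Rightarrow> 'a) \<Rightarrow> 'v set" where
  "cluster G A D a b = {x \<in> A. \<exists>d\<in>D. (\<lambda>x y. adj G x y \<and>
     x \<in> disagreement A a b \<union> D \<and> y \<in> disagreement A a b \<union> D)\<^sup>*\<^sup>* x d}"

definition swap :: "'v set \<Rightarrow> ('v \<Rightarrow> 'a) \<times> ('v \<Rightarrow> 'a) \<Rightarrow> ('v \<Rightarrow> 'a) \<times> ('v \<Rightarrow> 'a)" where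
  "swap K = (\<lambda>(a, b). (\<lambda>x. if x \<in> K then a x else b x, \<lambda>x. if x \<in> K then b x else a x))"

lemma disagreement_commute: "disagreement X f g = disagreement X g f"
  by (auto simp: disagreement_def)

lemma cluster_cong: "disagreement A a b = disagreement A a' b' \<Longrightarrow> cluster G A D a b = cluster G A D a' b'"
  by (simp add: cluster_def)

lemma cluster_swap:
  "cluster G A D (fst (swap K (a, b))) (snd (swap K (a, b))) = cluster G A D a b"
  by (rule cluster_cong) (auto simp: swap_def disagreement_def)

lemma swap_swap: "swap K (swap K p) = p"
  by (auto simp: swap_def fun_eq_iff split: prod.split)

lemma cluster_neighbour:
  assumes "x \<in> cluster G A D a b \<union> D" "adj G x y" "y \<in> A" "y \<notin> cluster G A D a b"
    and "A \<inter> D = {}"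
  shows "a y = b y"
proof (rule ccontr)
  assume ne: "a y \<noteq> b y"
  let ?d = "disagreement A a b \<union> D"
  let ?R = "\<lambda>x y. adj G x y \<and> x \<in> ?d \<and> y \<in> ?d"
  have y: "y \<in> ?d" using ne assms by (simp add: disagreement_def)
  obtain d where d: "d \<in> D" "?R\<^sup>*\<^sup>* x d" using assms(1) by (auto simp: cluster_def)
  from d(2) have "x \<in> ?d" by (cases rule: converse_rtranclpE) (use d(1) in auto)
  then have "?R y x" using y assms(2) by (simp add: adj_commute)
  then have "?R\<^sup>*\<^sup>* y d" using d(2) by (rule converse_rtranclp_into_rtranclp)
  then show False using d(1) assms(3,4) by (auto simp: cluster_def)
qed

text \<open>Off the cluster but next to it or to \<open>D\<close> the two configurations agree, so exchanging them off the
  cluster respects both boundary conditions.\<close>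

lemma swap_compatible_fst:
  assumes G: "ugraph G" and A: "A \<subseteq> verts G" and w: "\<omega>\<^sub>1 \<in> Hom G H" "\<omega>\<^sub>2 \<in> Hom G H"
    and a: "a \<in> compatible G H A \<omega>\<^sub>1" and b: "b \<in> compatible G H A \<omega>\<^sub>2"
    and K: "K = cluster G A (disagreement (boundary G A) \<omega>\<^sub>1 \<omega>\<^sub>2) a b"
  shows "fst (swap K (a, b)) \<in> compatible G H A \<omega>\<^sub>1"
proof -
  let ?D = "disagreement (boundary G A) \<omega>\<^sub>1 \<omega>\<^sub>2"
  let ?c = "fst (swap K (a, b))"
  have AD: "A \<inter> ?D = {}" using mem_boundary_iff[OF G A] by (auto simp: disagreement_def)
  have ab: "a \<in> extensional A" "override_on \<omega>\<^sub>1 a A \<in> Hom G H"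
    "b \<in> extensional A" "override_on \<omega>\<^sub>2 b A \<in> Hom G H"
    using a b compatible_iff[OF w(1) A] compatible_iff[OF w(2) A] by auto
  have KA: "K \<subseteq> A" by (auto simp: K cluster_def)
  have nb: "a y = b y" if "x \<in> K \<union> ?D" "adj G x y" "y \<in> A" "y \<notin> K" for x y
    using cluster_neighbour[of x G A ?D a b y] that AD K by auto
  have key: "adj H (override_on \<omega>\<^sub>1 ?c A x) (override_on \<omega>\<^sub>1 ?c A y)"
    if xy: "adj G x y" "x \<in> A" for x y
  proof -
    have 1: "adj H (a x) (override_on \<omega>\<^sub>1 a A y)" using Hom_adj[OF ab(2) xy(1)] xy(2) by simp
    have 2: "adj H (b x) (override_on \<omega>\<^sub>2 b A y)" using Hom_adj[OF ab(4) xy(1)] xy(2) by simp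
    have yx: "adj G y x" using xy(1) by (simp add: adj_commute)
    have "\<omega>\<^sub>1 y = \<omega>\<^sub>2 y \<or> a x = b x" if "y \<notin> A" "x \<notin> K"
    proof -
      have "y \<in> boundary G A" using mem_boundary_iff[OF G A] yx xy that by blast
      then show ?thesis using nb[of y x] yx xy(2) that by (auto simp: disagreement_def)
    qed
    then show ?thesis
      using 1 2 xy(2) KA nb[of x y] nb[of y x] xy yx
      by (cases "x \<in> K"; cases "y \<in> A"; cases "y \<in> K") (auto simp: swap_def)
  qed
  have "override_on \<omega>\<^sub>1 ?c A \<in> Hom G H"
  proof (rule HomI)
    fix x y assume xy: "adj G x y"
    then have yx: "adj G y x" by (simp add: adj_commute)
    show "adj H (override_on \<omega>\<^sub>1 ?c A x) (override_on \<omega>\<^sub>1 ?c A y)"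
      using key[OF xy] key[OF yx] Hom_adj[OF w(1) xy]
      by (cases "x \<in> A"; cases "y \<in> A") (simp_all add: adj_commute)
  next
    fix x
    show "override_on \<omega>\<^sub>1 ?c A x \<in> verts H" if "x \<in> verts G"
      using Hom_in_verts[OF w(1) that] Hom_in_verts[OF ab(2) that] Hom_in_verts[OF ab(4) that]
      by (auto simp: override_on_def swap_def)
    show "override_on \<omega>\<^sub>1 ?c A x = undefined" if "x \<notin> verts G"
      using Hom_undefined[OF w(1) that] that A by (auto simp: override_on_def)
  qed
  moreover have "?c \<in> extensional A" using ab KA by (auto simp: swap_def extensional_def)
  ultimately show ?thesis using compatible_iff[OF w(1) A] by simp
qed

lemma swap_compatible:
  assumes G: "ugraph G" and A: "A \<subseteq> verts G" and w: "\<omega>\<^sub>1 \<in> Hom G H" "\<omega>\<^sub>2 \<in> Hom G H"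
    and p: "(a, b) \<in> compatible G H A \<omega>\<^sub>1 \<times> compatible G H A \<omega>\<^sub>2"
    and K: "K = cluster G A (disagreement (boundary G A) \<omega>\<^sub>1 \<omega>\<^sub>2) a b"
  shows "swap K (a, b) \<in> compatible G H A \<omega>\<^sub>1 \<times> compatible G H A \<omega>\<^sub>2"
proof -
  have K': "K = cluster G A (disagreement (boundary G A) \<omega>\<^sub>2 \<omega>\<^sub>1) b a"
    unfolding K cluster_def disagreement_commute[of _ a b] disagreement_commute[of _ \<omega>\<^sub>1 \<omega>\<^sub>2] ..
  have "snd (swap K (a, b)) = fst (swap K (b, a))" by (simp add: swap_def)
  then show ?thesis
    using swap_compatible_fst[OF G A w _ _ K] swap_compatible_fst[OF G A w(2,1) _ _ K'] p
    by (auto simp: mem_Times_iff)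
qed

text \<open>A shortest path of disagreement from \<open>b0\<close> to \<open>D\<close> has no repetitions; its \<open>N\<close> vertices after \<open>b0\<close> are
  still at distance at least \<open>n - N\<close> from \<open>D\<close>.\<close>

lemma disagreement_path:
  assumes G: "ugraph G" and AD: "A \<inter> D = {}" and b0: "b0 \<in> cluster G A D a b"
    and far: "\<forall>d\<in>D. \<forall>k. (adj G ^^ k) b0 d \<longrightarrow> n \<le> k"
    and N: "N < n \<or> N = 0"
  obtains p where "length p = N" "successively (adj G) (b0 # p)" "distinct p"
    "set p \<subseteq> disagreement A a b"
    "\<And>x d k. x \<in> set p \<Longrightarrow> d \<in> D \<Longrightarrow> (adj G ^^ k) x d \<Longrightarrow> n \<le> N + k"
proof -
  let ?d = "disagreement A a b \<union> D"
  define R where "R = (\<lambda>x y. adj G x y \<and> x \<in> ?d \<and> y \<in> ?d)"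
  have R_adj: "(adj G ^^ k) x y" if "(R ^^ k) x y" for k x y
    using that by (induction k arbitrary: y) (auto simp: R_def)
  define P where "P k \<longleftrightarrow> (\<exists>d\<in>D. (R ^^ k) b0 d)" for k
  have "\<exists>k. P k" using b0 unfolding cluster_def P_def R_def by (auto simp: rtranclp_power)
  define k where "k = (LEAST k. P k)"
  have min: "k \<le> j" if "P j" for j unfolding k_def using that by (rule Least_le)
  have "P k" unfolding k_def by (rule LeastI_ex) fact
  then obtain d where d: "d \<in> D" "(R ^^ k) b0 d" unfolding P_def by blast
  then obtain f where f: "f 0 = b0" "f k = d" "\<And>i. i < k \<Longrightarrow> R (f i) (f (Suc i))"
    by (auto simp: relpowp_fun_conv)
  have sub: "(R ^^ (j - i)) (f i) (f j)" if "i \<le> j" "j \<le> k" for i j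
    unfolding relpowp_fun_conv using that f(3) by (intro exI[of _ "\<lambda>l. f (i + l)"]) auto
  have nk: "n \<le> k" using far d(1) R_adj[OF d(2)] by blast
  have ne: "f i \<noteq> f j" if "i < j" "j \<le> k" for i j
  proof
    assume "f i = f j"
    then have "(R ^^ (i + (k - j))) b0 d"
      using sub[of 0 i] sub[of j k] that f by (intro relpowp_trans[of _ _ _ "f i"]) auto
    then have "k \<le> i + (k - j)" using min d(1) P_def by blast
    then show False using that by simp
  qed
  define p where "p = map f [1..<Suc N]"
  have Nk: "i < k \<and> i < n" if "i \<in> set [1..<Suc N]" for i using that N nk by auto
  have b0p: "b0 # p = map f [0..<Suc N]"
    unfolding p_def using f(1) by (simp add: upt_conv_Cons del: upt_Suc)
  have "successively (adj G) (b0 # p)"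
    unfolding b0p successively_conv_nth using f(3) N nk by (auto simp: R_def simp del: upt_Suc)
  moreover have "distinct p"
    unfolding p_def distinct_map
  proof
    show "inj_on f (set [1..<Suc N])"
    proof (rule inj_onI)
      fix i j assume "i \<in> set [1..<Suc N]" "j \<in> set [1..<Suc N]" "f i = f j"
      then show "i = j" using ne[of i j] ne[of j i] Nk[of i] Nk[of j] by (cases i j rule: linorder_cases) auto
    qed
  qed simp
  moreover have fd: "n \<le> N + l" if x: "x \<in> set p" and d': "d' \<in> D" "(adj G ^^ l) x d'" for x d' l
  proof -
    obtain i where i: "x = f i" "i \<in> set [1..<Suc N]" using x by (auto simp: p_def simp del: upt_Suc)
    have "(adj G ^^ i) b0 x" using R_adj[OF sub[of 0 i]] Nk[OF i(2)] f(1) i(1) by simp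
    from relpowp_trans[OF this d'(2)] have "n \<le> i + l" using far d'(1) by blast
    then show ?thesis using i(2) by auto
  qed
  moreover have "set p \<subseteq> disagreement A a b"
  proof
    fix x assume x: "x \<in> set p"
    then obtain i where i: "x = f i" "i \<in> set [1..<Suc N]" by (auto simp: p_def simp del: upt_Suc)
    have "x \<in> ?d" using f(3)[of i] Nk[OF i(2)] i(1) by (auto simp: R_def)
    moreover have "x \<notin> D" using fd[OF x, of x 0] N x by (auto simp: p_def)
    ultimately show "x \<in> disagreement A a b" by blast
  qed
  ultimately show ?thesis using that[of p] by (simp add: p_def)
qed

section \<open>Exponential strong spatial mixing\<close>

context loop_rooted_tree
begin

lemma weight_swap:
  "weight L A (fst (swap K (a, b))) * weight L A (snd (swap K (a, b))) = weight L A a * weight L A b"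
proof -
  have "(\<Sum>x\<in>A. real (height - dep (fst (swap K (a, b)) x))) + (\<Sum>x\<in>A. real (height - dep (snd (swap K (a, b)) x)))
      = (\<Sum>x\<in>A. real (height - dep (a x))) + (\<Sum>x\<in>A. real (height - dep (b x)))"
    unfolding sum.distrib[symmetric] by (intro sum.cong) (auto simp: swap_def)
  then show ?thesis unfolding weight_def exp_add[symmetric] distrib_left[symmetric] by simp
qed

context
  fixes G :: "'v ugraph" and \<Delta> :: nat and A :: "'v set" and \<omega>\<^sub>1 \<omega>\<^sub>2 :: "'v \<Rightarrow> 'a" and B :: "'v set"
    and L :: real
  assumes G: "ugraph G"
    and deg: "degree_bound G \<Delta>"
    and A: "finite A" "A \<subseteq> verts G" and B: "B \<subseteq> A"
    and w: "\<omega>\<^sub>1 \<in> Hom G H" "\<omega>\<^sub>2 \<in> Hom G H"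
begin

abbreviation (input) "Dis \<equiv> disagreement (boundary G A) \<omega>\<^sub>1 \<omega>\<^sub>2"

definition connected_pairs :: "(('v \<Rightarrow> 'a) \<times> ('v \<Rightarrow> 'a)) set" where
  "connected_pairs = {(a, b) \<in> compatible G H A \<omega>\<^sub>1 \<times> compatible G H A \<omega>\<^sub>2. cluster G A Dis a b \<inter> B \<noteq> {}}"

text \<open>The swap is a weight-preserving involution on the pairs of configurations whose cluster misses \<open>B\<close>,
  and it exchanges the two restrictions to \<open>B\<close>. Such pairs contribute equally to both marginals, which
  leaves the pairs whose cluster meets \<open>B\<close>.\<close>

lemma marginal_diff_le:
  "\<bar>gibbs_marginal G H (root_interaction L) A \<omega>\<^sub>1 B \<beta> - gibbs_marginal G H (root_interaction L) A \<omega>\<^sub>2 B \<beta>\<bar>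
   \<le> (\<Sum>(a, b)\<in>connected_pairs. weight L A a * weight L A b) /
      (partition_sum G L A \<omega>\<^sub>1 * partition_sum G L A \<omega>\<^sub>2)"
proof -
  let ?C1 = "compatible G H A \<omega>\<^sub>1" and ?C2 = "compatible G H A \<omega>\<^sub>2"
  let ?Z1 = "partition_sum G L A \<omega>\<^sub>1" and ?Z2 = "partition_sum G L A \<omega>\<^sub>2"
  let ?W = "\<lambda>(a, b). weight L A a * weight L A b"
  let ?bad = connected_pairs
  define good where "good = ?C1 \<times> ?C2 - ?bad"
  have fin: "finite ?C1" "finite ?C2" using finite_compatible A(1) finite_verts by blast+
  have Z: "0 < ?Z1" "0 < ?Z2" using partition_sum_pos G A w by blast+
  have bad_sub: "?bad \<subseteq> ?C1 \<times> ?C2" by (auto simp: connected_pairs_def)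
  have finb: "finite ?bad" "finite good" using bad_sub fin finite_subset good_def by blast+
  have W: "0 \<le> ?W p" for p by (auto simp: weight_nonneg split: prod.split)
  have split: "sum ?W {p \<in> ?C1 \<times> ?C2. Q p} = sum ?W {p \<in> good. Q p} + sum ?W {p \<in> ?bad. Q p}" for Q
  proof -
    have "{p \<in> ?C1 \<times> ?C2. Q p} = {p \<in> good. Q p} \<union> {p \<in> ?bad. Q p}"
      using bad_sub by (auto simp: good_def)
    moreover have "{p \<in> good. Q p} \<inter> {p \<in> ?bad. Q p} = {}" by (auto simp: good_def)
    ultimately show ?thesis using finb by (simp add: sum.union_disjoint)
  qed
  define \<tau> where "\<tau> = (\<lambda>(a :: 'v \<Rightarrow> 'a, b). swap (cluster G A Dis a b) (a, b))"
  have tau: "\<tau> p \<in> good" "\<tau> (\<tau> p) = p" "?W (\<tau> p) = ?W p"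
      "restrict (fst (\<tau> p)) B = restrict (snd p) B" "restrict (snd (\<tau> p)) B = restrict (fst p) B"
    if "p \<in> good" for p
  proof -
    obtain a b where p: "p = (a, b)" by (cases p)
    let ?K = "cluster G A Dis a b"
    obtain a' b' where s: "swap ?K (a, b) = (a', b')" by (cases "swap ?K (a, b)")
    have K: "cluster G A Dis a' b' = ?K" using cluster_swap[of G A Dis ?K a b] s by simp
    have ab: "(a, b) \<in> ?C1 \<times> ?C2" "?K \<inter> B = {}"
      using that p by (auto simp: good_def connected_pairs_def)
    have "(a', b') \<in> ?C1 \<times> ?C2" using swap_compatible[OF G A(2) w ab(1) refl] s by simp
    then show "\<tau> p \<in> good" using K ab(2) s p by (auto simp: good_def connected_pairs_def \<tau>_def)
    show "\<tau> (\<tau> p) = p" using swap_swap[of ?K "(a, b)"] K s p by (simp add: \<tau>_def)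
    show "?W (\<tau> p) = ?W p" using weight_swap[of L A ?K a b] s p by (simp add: \<tau>_def)
    show "restrict (fst (\<tau> p)) B = restrict (snd p) B" "restrict (snd (\<tau> p)) B = restrict (fst p) B"
      using ab(2) p by (auto simp: \<tau>_def swap_def restrict_def fun_eq_iff)
  qed
  have sym: "sum ?W {p \<in> good. restrict (fst p) B = \<beta>} = sum ?W {p \<in> good. restrict (snd p) B = \<beta>}"
    by (rule sum.reindex_bij_witness[of _ \<tau> \<tau>]) (use tau in auto)
  have m1: "gibbs_marginal G H (root_interaction L) A \<omega>\<^sub>1 B \<beta> =
      sum ?W {p \<in> ?C1 \<times> ?C2. restrict (fst p) B = \<beta>} / (?Z1 * ?Z2)"
  proof -
    have "{p \<in> ?C1 \<times> ?C2. restrict (fst p) B = \<beta>} = {\<alpha>. \<alpha> \<in> ?C1 \<and> restrict \<alpha> B = \<beta>} \<times> ?C2" by auto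
    then have "sum ?W {p \<in> ?C1 \<times> ?C2. restrict (fst p) B = \<beta>} =
        (\<Sum>\<alpha> | \<alpha> \<in> ?C1 \<and> restrict \<alpha> B = \<beta>. weight L A \<alpha>) * ?Z2"
      by (simp add: sum_product sum.cartesian_product partition_sum_def)
    then show ?thesis using Z by (simp add: gibbs_marginal_root[OF A(1)])
  qed
  have m2: "gibbs_marginal G H (root_interaction L) A \<omega>\<^sub>2 B \<beta> =
      sum ?W {p \<in> ?C1 \<times> ?C2. restrict (snd p) B = \<beta>} / (?Z1 * ?Z2)"
  proof -
    have "{p \<in> ?C1 \<times> ?C2. restrict (snd p) B = \<beta>} = ?C1 \<times> {\<alpha>. \<alpha> \<in> ?C2 \<and> restrict \<alpha> B = \<beta>}" by auto
    then have "sum ?W {p \<in> ?C1 \<times> ?C2. restrict (snd p) B = \<beta>} =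
        ?Z1 * (\<Sum>\<alpha> | \<alpha> \<in> ?C2 \<and> restrict \<alpha> B = \<beta>. weight L A \<alpha>)"
      by (simp add: sum_product sum.cartesian_product partition_sum_def)
    then show ?thesis using Z by (simp add: gibbs_marginal_root[OF A(1)])
  qed
  have le: "0 \<le> sum ?W {p \<in> ?bad. Q p}" "sum ?W {p \<in> ?bad. Q p} \<le> sum ?W ?bad" for Q
    using W finb by (auto intro!: sum_nonneg sum_mono2)
  have "\<bar>sum ?W {p \<in> ?C1 \<times> ?C2. restrict (fst p) B = \<beta>} - sum ?W {p \<in> ?C1 \<times> ?C2. restrict (snd p) B = \<beta>}\<bar>
      \<le> sum ?W ?bad"
    unfolding split sym using le[of "\<lambda>p. restrict (fst p) B = \<beta>"] le[of "\<lambda>p. restrict (snd p) B = \<beta>"]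
    by linarith
  then show ?thesis
    unfolding m1 m2 diff_divide_distrib[symmetric] using Z by (simp add: abs_div divide_right_mono)
qed

text \<open>Far from the disagreement of the boundary conditions their shallowest extensions coincide, so where
  two configurations disagree one of them leaves its shallowest extension. The bound is the union bound
  over the path of disagreement (\<open>\<Delta>\<close> choices per step) and over the set \<open>U\<close> of vertices of the path where
  the first configuration is the one that leaves it (2 choices per vertex). The last \<open>height + 1\<close>
  vertices of a path are given up, as the shallowest extensions may differ there.\<close>

lemma connected_pairs_weight_le:
  assumes L: "0 \<le> L" and n: "enat n \<le> gsetdist G B Dis"
  shows "(\<Sum>(a, b)\<in>connected_pairs. weight L A a * weight L A b) \<le>
    real (card B) * (2 * real \<Delta> * (real (card (verts H)) ^ ball_bound \<Delta> * exp (- L))) ^ (n - height - 1)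
    * (partition_sum G L A \<omega>\<^sub>1 * partition_sum G L A \<omega>\<^sub>2)"
proof -
  let ?C1 = "compatible G H A \<omega>\<^sub>1" and ?C2 = "compatible G H A \<omega>\<^sub>2"
  let ?Z1 = "partition_sum G L A \<omega>\<^sub>1" and ?Z2 = "partition_sum G L A \<omega>\<^sub>2"
  let ?W = "\<lambda>(a, b). weight L A a * weight L A b"
  let ?m = "shallowest G (boundary G A)"
  define N where "N = n - height - 1"
  define \<epsilon> where "\<epsilon> = real (card (verts H)) ^ ball_bound \<Delta> * exp (- L)"
  define E1 where "E1 U = {\<alpha> \<in> ?C1. \<forall>x\<in>U. \<alpha> x \<noteq> ?m \<omega>\<^sub>1 x}" for U
  define E2 where "E2 U = {\<alpha> \<in> ?C2. \<forall>x\<in>U. \<alpha> x \<noteq> ?m \<omega>\<^sub>2 x}" for U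
  define paths where "paths b = {p. length p = N \<and> successively (adj G) (b # p)}" for b
  define paths' where "paths' b = {p \<in> paths b. distinct p \<and> set p \<subseteq> A}" for b
  define I where "I = (SIGMA b:B. SIGMA p:paths' b. Pow (set p))"
  define S where "S = (\<lambda>(b::'v, p, U). E1 U \<times> E2 (set p - U))"
  have AD: "A \<inter> Dis = {}" using mem_boundary_iff[OF G A(2)] by (auto simp: disagreement_def)
  have Bfin: "finite B" using B A(1) finite_subset by blast
  have Z: "0 < ?Z1" "0 < ?Z2" using partition_sum_pos G A w by blast+
  have fin: "finite ?C1" "finite ?C2" using finite_compatible A(1) finite_verts by blast+
  have paths: "finite (paths b)" "card (paths b) \<le> \<Delta> ^ N" if "b \<in> B" for b
    using card_walks_le[OF G _ deg, of b N] that B A(2) by (auto simp: paths_def)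
  have paths': "finite (paths' b)" "card (paths' b) \<le> \<Delta> ^ N" if "b \<in> B" for b
    using paths[OF that] card_mono[OF paths(1)[OF that], of "paths' b"] by (auto simp: paths'_def)
  have finI: "finite I" unfolding I_def using Bfin paths' by auto
  have "card I = (\<Sum>b\<in>B. \<Sum>p\<in>paths' b. card (Pow (set p)))"
    unfolding I_def using Bfin paths' by (subst card_SigmaI) (auto simp: card_SigmaI intro!: sum.cong)
  also have "\<dots> = (\<Sum>b\<in>B. \<Sum>p\<in>paths' b. 2 ^ N)"
    by (intro sum.cong refl) (auto simp: card_Pow paths'_def paths_def distinct_card)
  also have "\<dots> \<le> (\<Sum>b\<in>B. \<Delta> ^ N * 2 ^ N)"
    using paths' by (intro sum_mono) auto
  finally have "card I \<le> card B * (\<Delta> ^ N * 2 ^ N)" by simp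
  then have cardI: "real (card I) \<le> real (card B) * (2 * real \<Delta>) ^ N"
    by (metis (mono_tags, lifting) mult.commute of_nat_le_iff of_nat_mult of_nat_numeral of_nat_power power_mult_distrib)
  have "sum ?W connected_pairs \<le> real (card I) * (\<epsilon> ^ N * (?Z1 * ?Z2))"
  proof (rule sum_le_cover[OF finI, where S = S])
    show "finite (S i)" for i
      using fin by (auto simp: S_def E1_def E2_def split: prod.split)
    show "0 \<le> ?W p" for p by (auto simp: weight_nonneg split: prod.split)
    show "sum ?W (S i) \<le> \<epsilon> ^ N * (?Z1 * ?Z2)" if "i \<in> I" for i
    proof -
      obtain b p U where i: "i = (b, p, U)" by (cases i)
      then have U: "U \<subseteq> set p" "set p \<subseteq> A" "card (set p) = N"
        using that by (auto simp: I_def paths'_def paths_def distinct_card)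
      have "sum ?W (S i) = sum (weight L A) (E1 U) * sum (weight L A) (E2 (set p - U))"
        by (simp add: S_def i sum_product sum.cartesian_product)
      also have "\<dots> \<le> (\<epsilon> ^ card U * ?Z1) * (\<epsilon> ^ card (set p - U) * ?Z2)"
        using peierls[OF G deg A w(1), of U L] peierls[OF G deg A w(2), of "set p - U" L] U L Z
        unfolding E1_def E2_def \<epsilon>_def
        by (intro mult_mono) (auto intro!: sum_nonneg weight_nonneg)
      also have "\<dots> = \<epsilon> ^ (card U + card (set p - U)) * (?Z1 * ?Z2)"
        by (simp add: power_add)
      also have "card U + card (set p - U) = N"
        using U card_mono[of "set p" U] by (simp add: card_Diff_subset finite_subset)
      finally show ?thesis .
    qed
    show "connected_pairs \<subseteq> (\<Union>i\<in>I. S i)"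
    proof
      fix q assume "q \<in> connected_pairs"
      then obtain a b b0 where q: "q = (a, b)" "a \<in> ?C1" "b \<in> ?C2" "b0 \<in> B" "b0 \<in> cluster G A Dis a b"
        by (auto simp: connected_pairs_def)
      have far: "\<forall>d\<in>Dis. \<forall>k. (adj G ^^ k) b0 d \<longrightarrow> n \<le> k"
        using n gsetdist_ge_iff[OF G, of B n Dis] B A(2) q(4) by blast
      have "N < n \<or> N = 0" unfolding N_def by auto
      from disagreement_path[OF G AD q(5) far this]
      obtain p where p: "length p = N" "successively (adj G) (b0 # p)" "distinct p"
        "set p \<subseteq> disagreement A a b"
        and pfar: "\<And>x d k. x \<in> set p \<Longrightarrow> d \<in> Dis \<Longrightarrow> (adj G ^^ k) x d \<Longrightarrow> n \<le> N + k" by blast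
      define U where "U = {x \<in> set p. a x \<noteq> ?m \<omega>\<^sub>1 x}"
      have "b x \<noteq> ?m \<omega>\<^sub>2 x" if "x \<in> set p - U" for x
      proof -
        have x: "x \<in> set p" "a x = ?m \<omega>\<^sub>1 x" "a x \<noteq> b x"
          using that p(4) by (auto simp: U_def disagreement_def)
        have "0 < N" using x(1) p(1) by (cases p) auto
        have "?m \<omega>\<^sub>1 x = ?m \<omega>\<^sub>2 x"
        proof (rule shallowest_local[OF G w])
          fix s k assume s: "(adj G ^^ k) s x" "k < height"
          have "s \<notin> Dis"
            using pfar[OF x(1) _ relpowp_adj_commute[OF s(1)]] s(2) \<open>0 < N\<close> by (auto simp: N_def)
          then show "(s \<in> boundary G A \<longleftrightarrow> s \<in> boundary G A) \<and> (s \<in> boundary G A \<longrightarrow> \<omega>\<^sub>1 s = \<omega>\<^sub>2 s)"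
            by (auto simp: disagreement_def)
        qed
        then show ?thesis using x by simp
      qed
      then have "(a, b) \<in> S (b0, p, U)" using q by (auto simp: S_def E1_def E2_def U_def)
      moreover have "(b0, p, U) \<in> I"
        using p q(4) by (auto simp: I_def paths'_def paths_def U_def disagreement_def)
      ultimately show "q \<in> (\<Union>i\<in>I. S i)" using q(1) by blast
    qed
  qed
  also have "\<dots> \<le> (real (card B) * (2 * real \<Delta>) ^ N) * (\<epsilon> ^ N * (?Z1 * ?Z2))"
    using Z by (intro mult_right_mono cardI) (auto simp: \<epsilon>_def)
  finally show ?thesis
    unfolding N_def[symmetric] \<epsilon>_def[symmetric] by (simp add: power_mult_distrib mult_ac)
qed

lemma connected_pairs_infinite:
  assumes "gsetdist G B Dis = \<infinity>"
  shows "connected_pairs = {}"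
proof -
  have "cluster G A Dis a b \<inter> B = {}" for a b
  proof (rule ccontr)
    assume "cluster G A Dis a b \<inter> B \<noteq> {}"
    then obtain x d where x: "x \<in> B" "d \<in> Dis" and R: "(\<lambda>x y. adj G x y \<and>
     x \<in> disagreement A a b \<union> Dis \<and> y \<in> disagreement A a b \<union> Dis)\<^sup>*\<^sup>* x d"
      by (auto simp: cluster_def)
    have "(adj G)\<^sup>*\<^sup>* x d" by (rule rtranclp_mono[THEN predicate2D, OF _ R]) auto
    then obtain k where "(adj G ^^ k) x d" by (auto simp: rtranclp_power)
    then have "gsetdist G B Dis < enat (Suc k)"
      using gsetdist_less_iff[OF G, of B Dis "Suc k"] x B A(2) by blast
    then show False using assms by simp
  qed
  then show ?thesis by (auto simp: connected_pairs_def)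
qed

end

text \<open>Increasing the strength \<open>L\<close> of the interaction makes the factor per step of a path as small as
  desired, here \<open>exp (- \<gamma>)\<close>; the steps given up near the boundary go into \<open>C\<close>.\<close>

lemma exp_SSM_of_loop_rooted:
  assumes G: "ugraph G"
    and deg: "degree_bound G \<Delta>"
    and \<gamma>: "0 < \<gamma>"
  shows "\<exists>\<Phi>. nn_interaction H \<Phi> \<and> exp_SSM G H \<Phi> \<gamma>"
proof -
  define c where "c = real (max 1 \<Delta>) * 2 * real (card (verts H)) ^ ball_bound (max 1 \<Delta>)"
  have cv: "1 \<le> real (card (verts H))"
    using finite_verts root_in_verts by (auto simp: Suc_le_eq card_gt_0_iff)
  have deg': "degree_bound G (max 1 \<Delta>)"
    using deg by (auto simp: degree_bound_def)
  have c: "1 \<le> c"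
  proof -
    have "1 * 1 \<le> (real (max 1 \<Delta>) * 2) * real (card (verts H)) ^ ball_bound (max 1 \<Delta>)"
      by (intro mult_mono one_le_power cv) auto
    then show ?thesis by (simp add: c_def)
  qed
  define L where "L = \<gamma> + ln c"
  have L: "0 \<le> L" using \<gamma> c by (simp add: L_def)
  have base: "2 * real (max 1 \<Delta>) * (real (card (verts H)) ^ ball_bound (max 1 \<Delta>) * exp (- L)) = exp (- \<gamma>)"
  proof -
    have "c * exp (- L) = exp (- \<gamma>)" using c by (simp add: L_def exp_diff exp_minus field_simps exp_add)
    then show ?thesis by (simp add: c_def mult_ac)
  qed
  define C where "C = exp (\<gamma> * (real height + 1))"
  have "exp_SSM G H (root_interaction L) \<gamma>"
    unfolding exp_SSM_def
  proof (intro exI[of _ C] conjI allI impI ballI)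
    show "0 < C" by (simp add: C_def)
    fix A B \<beta> \<omega>1 \<omega>2
    assume "finite A \<and> A \<subseteq> verts G \<and> B \<subseteq> A" and w: "\<omega>1 \<in> Hom G H" "\<omega>2 \<in> Hom G H"
    then have A: "finite A" "A \<subseteq> verts G" "B \<subseteq> A" by auto
    let ?D = "disagreement (boundary G A) \<omega>1 \<omega>2"
    let ?ZZ = "partition_sum G L A \<omega>1 * partition_sum G L A \<omega>2"
    let ?bad = "\<Sum>(a, b)\<in>connected_pairs G A \<omega>1 \<omega>2 B. weight L A a * weight L A b"
    have Z: "0 < ?ZZ" using partition_sum_pos G A w by (intro mult_pos_pos) blast+
    note le = marginal_diff_le[OF G deg' A w, of L \<beta>]
    show "\<bar>gibbs_marginal G H (root_interaction L) A \<omega>1 B \<beta> - gibbs_marginal G H (root_interaction L) A \<omega>2 B \<beta>\<bar>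
        \<le> real (card B) * exp_decay C \<gamma> (gsetdist G B ?D)"
    proof (cases "gsetdist G B ?D")
      case (enat n)
      have "?bad / ?ZZ \<le> real (card B) * exp (- \<gamma>) ^ (n - height - 1)"
        using connected_pairs_weight_le[OF G deg' A w L, of n] Z enat
        unfolding base by (simp add: pos_divide_le_eq)
      also have "exp (- \<gamma>) ^ (n - height - 1) \<le> C * exp (- \<gamma> * real n)"
      proof -
        have "real n - real height - 1 \<le> real (n - height - 1)" by linarith
        then have "- \<gamma> * real (n - height - 1) \<le> \<gamma> * (real height + 1) + - \<gamma> * real n"
          using mult_left_mono[of _ _ \<gamma>] \<gamma> by (fastforce simp: algebra_simps)
        then show ?thesis unfolding C_def exp_add[symmetric]
          by (simp add: exp_of_nat_mult[symmetric] mult.commute)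
      qed
      finally show ?thesis using le enat by (simp add: exp_decay_def mult_left_mono)
    next
      case infinity
      then show ?thesis using le connected_pairs_infinite[OF G deg' A w] by (simp add: exp_decay_def)
    qed
  qed
  then show ?thesis using nn_interaction_root[OF L] by blast
qed

end

section \<open>Long-range rigidity\<close>

text \<open>Two boundary conditions that differ only far from \<open>z\<close> and yet exclude a common value at \<open>z\<close>: if this
  happens at all distances, then both forms of mixing fail.\<close>

definition separated_from_afar ::
    "'v ugraph \<Rightarrow> 'a ugraph \<Rightarrow> nat \<Rightarrow> 'v set \<Rightarrow> 'v \<Rightarrow> ('v \<Rightarrow> 'a) \<Rightarrow> ('v \<Rightarrow> 'a) \<Rightarrow> bool" where
  "separated_from_afar G H m R z \<omega>\<^sub>1 \<omega>\<^sub>2 \<longleftrightarrow>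
     finite R \<and> R \<subseteq> verts G \<and> z \<in> R \<and> \<omega>\<^sub>1 \<in> Hom G H \<and> \<omega>\<^sub>2 \<in> Hom G H \<and>
     enat m \<le> gsetdist G {z} (disagreement (boundary G R) \<omega>\<^sub>1 \<omega>\<^sub>2) \<and>
     (\<forall>f\<^sub>1\<in>Hom G H. \<forall>f\<^sub>2\<in>Hom G H.
        (\<forall>x\<in>boundary G R. f\<^sub>1 x = \<omega>\<^sub>1 x) \<longrightarrow> (\<forall>x\<in>boundary G R. f\<^sub>2 x = \<omega>\<^sub>2 x) \<longrightarrow> f\<^sub>1 z \<noteq> f\<^sub>2 z)"

definition long_range_rigid :: "'v ugraph \<Rightarrow> 'a ugraph \<Rightarrow> bool" where
  "long_range_rigid G H \<longleftrightarrow> (\<forall>m. \<exists>R z \<omega>\<^sub>1 \<omega>\<^sub>2. separated_from_afar G H m R z \<omega>\<^sub>1 \<omega>\<^sub>2)"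

lemma rigid_not_TSSM:
  assumes rig: "long_range_rigid G H" and G: "ugraph G"
    and fin: "\<And>v. v \<in> verts G \<Longrightarrow> finite {w. adj G v w}"
  shows "\<not> TSSM G H"
proof
  assume "TSSM G H"
  then obtain g where g: "\<forall>A B S.
     finite A \<and> finite B \<and> finite S \<and> A \<subseteq> verts G \<and> B \<subseteq> verts G \<and> S \<subseteq> verts G \<and>
     A \<inter> B = {} \<and> A \<inter> S = {} \<and> B \<inter> S = {} \<and> gsetdist G A B \<ge> enat g \<longrightarrow>
     (\<forall>\<omega>\<^sub>1\<in>Hom G H. \<forall>\<omega>\<^sub>2\<in>Hom G H. (\<forall>x\<in>S. \<omega>\<^sub>1 x = \<omega>\<^sub>2 x) \<longrightarrow>
       (\<exists>\<omega>\<in>Hom G H. (\<forall>x\<in>A \<union> S. \<omega> x = \<omega>\<^sub>1 x) \<and> (\<forall>x\<in>B. \<omega> x = \<omega>\<^sub>2 x)))"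
    unfolding TSSM_iff_points by (rule exE)
  obtain R z \<omega>1 \<omega>2 where sep: "separated_from_afar G H g R z \<omega>1 \<omega>2"
    using rig unfolding long_range_rigid_def by blast
  have R: "finite R" "R \<subseteq> verts G" "z \<in> R" "\<omega>1 \<in> Hom G H" "\<omega>2 \<in> Hom G H"
    "enat g \<le> gsetdist G {z} (disagreement (boundary G R) \<omega>1 \<omega>2)"
    using sep by (simp_all add: separated_from_afar_def)
  have ne: "f1 z \<noteq> f2 z" if "f1 \<in> Hom G H" "f2 \<in> Hom G H" "\<forall>x\<in>boundary G R. f1 x = \<omega>1 x"
        "\<forall>x\<in>boundary G R. f2 x = \<omega>2 x" for f1 f2
    using sep that by (simp add: separated_from_afar_def)
  let ?D = "disagreement (boundary G R) \<omega>1 \<omega>2"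
  have fb: "finite (boundary G R)" using finite_boundary[OF G R(2,1)] fin by blast
  have bv: "boundary G R \<subseteq> verts G" "boundary G R \<inter> R = {}"
    using mem_boundary_iff[OF G R(2)] by (auto simp: boundary_def)
  have Db: "?D \<subseteq> boundary G R" by (auto simp: disagreement_def)
  obtain \<omega> where \<omega>: "\<omega> \<in> Hom G H" "\<forall>x\<in>{z} \<union> (boundary G R - ?D). \<omega> x = \<omega>1 x" "\<forall>x\<in>?D. \<omega> x = \<omega>2 x"
  proof -
    have "\<exists>\<omega>\<in>Hom G H. (\<forall>x\<in>{z} \<union> (boundary G R - ?D). \<omega> x = \<omega>1 x) \<and> (\<forall>x\<in>?D. \<omega> x = \<omega>2 x)"
    proof (rule g[rule_format, OF _ R(4,5)], intro conjI)
      show "finite ?D" by (rule finite_subset[OF Db fb])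
      show "enat g \<le> gsetdist G {z} ?D" by (rule R(6))
      show "\<omega>1 x = \<omega>2 x" if "x \<in> boundary G R - ?D" for x
        using that by (auto simp: disagreement_def)
    qed (use fb bv R Db in auto)
    then show ?thesis using that by blast
  qed
  have "\<forall>x\<in>boundary G R. \<omega> x = \<omega>2 x"
    using \<omega>(2,3) by (auto simp: disagreement_def)
  then have "\<omega>1 z \<noteq> \<omega> z" by (intro ne[OF R(4) \<omega>(1)]) simp_all
  then show False using \<omega>(2) by simp
qed

lemma rigid_not_SSM:
  fixes H :: "'a ugraph"
  assumes rig: "long_range_rigid G H" and G: "ugraph G" and finH: "finite (verts H)" and \<gamma>: "0 < \<gamma>"
  shows "\<not> exp_SSM G H \<Phi> \<gamma>"
proof
  assume "exp_SSM G H \<Phi> \<gamma>"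
  then obtain C where C: "0 < C"
    and SSM: "\<forall>A B. finite A \<and> A \<subseteq> verts G \<and> B \<subseteq> A \<longrightarrow>
       (\<forall>\<beta>\<in>B \<rightarrow>\<^sub>E verts H. \<forall>\<omega>\<^sub>1\<in>Hom G H. \<forall>\<omega>\<^sub>2\<in>Hom G H.
        \<bar>gibbs_marginal G H \<Phi> A \<omega>\<^sub>1 B \<beta> - gibbs_marginal G H \<Phi> A \<omega>\<^sub>2 B \<beta>\<bar>
        \<le> real (card B) * exp_decay C \<gamma> (gsetdist G B (disagreement (boundary G A) \<omega>\<^sub>1 \<omega>\<^sub>2)))"
    unfolding exp_SSM_def by (elim exE conjE) (rule that)
  let ?n = "real (card (verts H))"
  obtain m :: nat where m: "C * ?n < exp (\<gamma> * real m)"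
  proof -
    obtain m :: nat where "C * ?n / \<gamma> < real m" using reals_Archimedean2 by blast
    then have "C * ?n < \<gamma> * real m" using \<gamma> by (simp add: field_simps)
    also have "\<dots> < exp (\<gamma> * real m)" using exp_ge_add_one_self[of "\<gamma> * real m"] by linarith
    finally show ?thesis using that by blast
  qed
  obtain R z \<omega>1 \<omega>2 where sep: "separated_from_afar G H m R z \<omega>1 \<omega>2"
    using rig unfolding long_range_rigid_def by blast
  have R: "finite R" "R \<subseteq> verts G" "z \<in> R" "\<omega>1 \<in> Hom G H" "\<omega>2 \<in> Hom G H"
    "enat m \<le> gsetdist G {z} (disagreement (boundary G R) \<omega>1 \<omega>2)"
    using sep by (simp_all add: separated_from_afar_def)
  have ne: "f1 z \<noteq> f2 z" if "f1 \<in> Hom G H" "f2 \<in> Hom G H" "\<forall>x\<in>boundary G R. f1 x = \<omega>1 x"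
        "\<forall>x\<in>boundary G R. f2 x = \<omega>2 x" for f1 f2
    using sep that by (simp add: separated_from_afar_def)
  define pr where "pr \<omega> v = gibbs_marginal G H \<Phi> R \<omega> {z} (restrict (\<lambda>_. v) {z})" for \<omega> v
  have fc: "finite (compatible G H R \<omega>)" for \<omega> using finite_compatible R(1) finH by blast
  have fE: "finite (R \<rightarrow>\<^sub>E verts H)" using finite_PiE[OF R(1), of "\<lambda>_. verts H"] finH by simp
  have eqz: "restrict \<alpha> {z} = restrict (\<lambda>_. v) {z} \<longleftrightarrow> \<alpha> z = v" for \<alpha> :: "'b \<Rightarrow> 'a" and v
    by (auto simp: fun_eq_iff restrict_def)
  have pr: "pr \<omega> v = (\<Sum>\<alpha> | \<alpha> \<in> R \<rightarrow>\<^sub>E verts H \<and> \<alpha> z = v. gibbs G H \<Phi> R \<omega> \<alpha>)" for \<omega> v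
    unfolding pr_def gibbs_marginal_def eqz ..
  have compz: "restrict \<omega> R \<in> compatible G H R \<omega>" if "\<omega> \<in> Hom G H" for \<omega>
    by (rule restrict_compatible[OF G R(2) that that]) simp
  have total: "(\<Sum>v\<in>verts H. pr \<omega>1 v) = 1"
  proof -
    let ?Z = "\<Sum>\<alpha>'\<in>compatible G H R \<omega>1. exp (- energy G \<Phi> R \<omega>1 \<alpha>')"
    have "0 < ?Z" using fc compz[OF R(4)] by (intro sum_pos) auto
    have "(\<Sum>v\<in>verts H. pr \<omega>1 v) = (\<Sum>\<alpha>\<in>R \<rightarrow>\<^sub>E verts H. gibbs G H \<Phi> R \<omega>1 \<alpha>)"
      unfolding pr using R(3) by (intro sum.group[OF fE finH]) auto
    also have "\<dots> = (\<Sum>\<alpha>\<in>compatible G H R \<omega>1. exp (- energy G \<Phi> R \<omega>1 \<alpha>) / ?Z)"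
      by (rule sum.mono_neutral_cong_right[OF fE]) (auto simp: gibbs_def compatible_def)
    also have "\<dots> = 1" using \<open>0 < ?Z\<close> by (simp add: sum_divide_distrib[symmetric])
    finally show ?thesis .
  qed
  have pos: "\<exists>f\<in>Hom G H. (\<forall>x\<in>boundary G R. f x = \<omega> x) \<and> f z = v"
    if w: "\<omega> \<in> Hom G H" and nz: "pr \<omega> v \<noteq> 0" for \<omega> v
  proof -
    obtain \<alpha> where \<alpha>: "\<alpha> z = v" "gibbs G H \<Phi> R \<omega> \<alpha> \<noteq> 0"
      using nz unfolding pr by (auto dest: sum.not_neutral_contains_not_neutral)
    then have "\<alpha> \<in> compatible G H R \<omega>" by (auto simp: gibbs_def split: if_splits)
    then have "override_on \<omega> \<alpha> R \<in> Hom G H" using compatible_iff[OF w R(2)] by blast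
    moreover have "\<forall>x\<in>boundary G R. override_on \<omega> \<alpha> R x = \<omega> x"
      using mem_boundary_iff[OF G R(2)] by auto
    ultimately show ?thesis using \<alpha>(1) R(3) by (intro bexI[of _ "override_on \<omega> \<alpha> R"]) auto
  qed
  \<comment> \<open>No value has positive probability under both boundary conditions, so mixing makes every value improbable under the first.\<close>
  have "pr \<omega>1 v \<le> C / exp (\<gamma> * real m)" if v: "v \<in> verts H" for v
  proof (cases "pr \<omega>1 v = 0")
    case False
    have "pr \<omega>2 v = 0"
    proof (rule ccontr)
      assume "pr \<omega>2 v \<noteq> 0"
      then obtain f1 f2 where "f1 \<in> Hom G H" "\<forall>x\<in>boundary G R. f1 x = \<omega>1 x" "f1 z = v"
        "f2 \<in> Hom G H" "\<forall>x\<in>boundary G R. f2 x = \<omega>2 x" "f2 z = v"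
        using pos[OF R(4) False] pos[OF R(5)] by metis
      then show False using ne[of f1 f2] by simp
    qed
    then have "pr \<omega>1 v \<le> exp_decay C \<gamma> (gsetdist G {z} (disagreement (boundary G R) \<omega>1 \<omega>2))"
      using SSM[rule_format, OF _ _ R(4,5), of R "{z}" "restrict (\<lambda>_. v) {z}"] R(1-3) v
      by (simp add: pr_def)
    also have "\<dots> \<le> C * exp (- \<gamma> * real m)"
    proof (cases "gsetdist G {z} (disagreement (boundary G R) \<omega>1 \<omega>2)")
      case (enat n)
      then show ?thesis using R(6) C \<gamma> by (simp add: exp_decay_def)
    qed (use C in \<open>simp add: exp_decay_def\<close>)
    finally show ?thesis by (simp add: exp_minus field_simps)
  qed (use C in simp)
  then have "(\<Sum>v\<in>verts H. pr \<omega>1 v) \<le> (\<Sum>v\<in>verts H. C / exp (\<gamma> * real m))" by (intro sum_mono)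
  then show False using total m by (simp add: field_simps)
qed

section \<open>The square lattice\<close>

lemma adj_Z2: "adj Z2 x y \<longleftrightarrow> \<bar>fst x - fst y\<bar> + \<bar>snd x - snd y\<bar> = 1"
proof
  assume "\<bar>fst x - fst y\<bar> + \<bar>snd x - snd y\<bar> = 1"
  then have "{x, y} \<in> {{x, y} | x y. \<bar>fst x - fst y\<bar> + \<bar>snd x - snd y\<bar> = 1}"
    by (intro CollectI exI[of _ x] exI[of _ y]) simp
  then show "adj Z2 x y" by (simp add: adj_def Z2_def)
qed (auto simp: adj_def Z2_def doubleton_eq_iff)

lemma verts_Z2 [simp]: "verts Z2 = UNIV"
  by (simp add: Z2_def)

lemma ugraph_Z2: "ugraph Z2"
  by (auto simp: ugraph_def Z2_def)

lemma relpowp_Z2_le: "(adj Z2 ^^ n) x y \<Longrightarrow> \<bar>fst x - fst y\<bar> + \<bar>snd x - snd y\<bar> \<le> int n"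
proof (induction n arbitrary: y)
  case (Suc n)
  then obtain z where z: "(adj Z2 ^^ n) x z" "adj Z2 z y" by auto
  then show ?case using Suc.IH[OF z(1)] by (auto simp: adj_Z2)
qed auto

lemma relpowp_Z2_right: "(adj Z2 ^^ n) (x, y) (x + int n, y)"
  by (induction n) (auto simp: adj_Z2 intro!: relcomppI)

lemma relpowp_Z2_up: "(adj Z2 ^^ n) (x, y) (x, y + int n)"
  by (induction n) (auto simp: adj_Z2 intro!: relcomppI)

lemma neighbours_Z2: "{w. adj Z2 v w} = {(fst v + 1, snd v), (fst v - 1, snd v), (fst v, snd v + 1), (fst v, snd v - 1)}"
  by (cases v) (auto simp: adj_Z2)

lemma degree_bound_Z2: "degree_bound Z2 4"
  unfolding degree_bound_def neighbours_Z2
  by (auto intro!: order_trans[OF card_insert_le_m1])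

lemma walk_Z2_exists: "\<exists>n. (adj Z2 ^^ n) x y"
proof -
  have 1: "\<exists>n. (adj Z2 ^^ n) (a, b) (a', b)" for a a' b
  proof (cases "a \<le> a'")
    case True
    then show ?thesis using relpowp_Z2_right[of "nat (a' - a)" a b] by auto
  next
    case False
    then show ?thesis using relpowp_adj_commute[OF relpowp_Z2_right[of "nat (a - a')" a' b]] by auto
  qed
  have 2: "\<exists>n. (adj Z2 ^^ n) (a, b) (a, b')" for a b b'
  proof (cases "b \<le> b'")
    case True
    then show ?thesis using relpowp_Z2_up[of "nat (b' - b)" a b] by auto
  next
    case False
    then show ?thesis using relpowp_adj_commute[OF relpowp_Z2_up[of "nat (b - b')" a b']] by auto
  qed
  obtain n where "(adj Z2 ^^ n) x (fst y, snd x)" using 1[of "fst x" "snd x" "fst y"] by auto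
  moreover obtain m where "(adj Z2 ^^ m) (fst y, snd x) y" using 2[of "fst y" "snd x" "snd y"] by auto
  ultimately show ?thesis using relpowp_trans[of n "adj Z2" x "(fst y, snd x)" m y] by blast
qed

lemma gsetdist_Z2_ge:
  assumes "\<And>x y. (x, y) \<in> D \<Longrightarrow> int m \<le> \<bar>a - x\<bar> + \<bar>b - y\<bar>"
  shows "enat m \<le> gsetdist Z2 {(a, b)} D"
proof -
  have "m \<le> k" if "q \<in> D" "(adj Z2 ^^ k) (a, b) q" for q k
    using assms[of "fst q" "snd q"] relpowp_Z2_le[OF that(2)] that(1) by simp
  then show ?thesis using gsetdist_ge_iff[OF ugraph_Z2, of "{(a, b)}" m D] by simp
qed

section \<open>Rigid targets\<close>

context rooted_tree
begin

lemma dep_walk_le: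
  assumes "f \<in> Hom G H" "(adj G ^^ n) x y"
  shows "dep (f x) \<le> dep (f y) + n"
  using assms(2)
proof (induction n arbitrary: y)
  case (Suc n)
  then obtain z where z: "(adj G ^^ n) x z" "adj G z y" by auto
  have "dep (f z) \<le> dep (f y) + 1" by (rule adj_cases[OF Hom_adj[OF assms(1) z(2)]]) auto
  then show ?case using Suc.IH[OF z(1)] by simp
qed auto

lemma dep_walk_parity:
  assumes nl: "\<And>v. \<not> adj H v v" and "f \<in> Hom G H" "(adj G ^^ n) x y"
  shows "even (dep (f x)) \<longleftrightarrow> even (dep (f y) + n)"
  using assms(3)
proof (induction n arbitrary: y)
  case (Suc n)
  then obtain z where z: "(adj G ^^ n) x z" "adj G z y" by auto
  have a: "adj H (f z) (f y)" by (rule Hom_adj[OF assms(2) z(2)])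
  have "even (dep (f z)) \<longleftrightarrow> odd (dep (f y))" by (rule adj_cases[OF a]) (use nl a in auto)
  then show ?case using Suc.IH[OF z(1)] by auto
qed auto

text \<open>Without loops the target is bipartite, and so is the lattice: the side of the target on which a
  point has its value at one vertex fixes the sides of all its other values.\<close>

lemma rigid_of_no_loops:
  assumes nl: "\<And>v. \<not> adj H v v" and uw: "adj H u w"
  shows "long_range_rigid Z2 H"
  unfolding long_range_rigid_def
proof
  fix m :: nat
  define \<omega> where "\<omega> e = (\<lambda>(x, y). if even (x + y + e :: int) then u else w)" for e
  define R where "R = {- int m..int m} \<times> {- int m..int m}"
  have Hom: "\<omega> e \<in> Hom Z2 H" for e
  proof (rule HomI)
    show "\<omega> e x \<in> verts H" for x using adj_in_vertsH[OF uw] by (auto simp: \<omega>_def split: prod.split)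
    show "adj H (\<omega> e p) (\<omega> e q)" if pq: "adj Z2 p q" for p q
    proof -
      have "even (fst p + snd p) \<longleftrightarrow> odd (fst q + snd q)"
        using pq unfolding adj_Z2 by presburger
      then show ?thesis using uw adj_commute[of H u w] by (auto simp: \<omega>_def split: prod.split)
    qed
  qed simp
  have bd: "p \<in> boundary Z2 R \<longleftrightarrow> p \<notin> R \<and> (\<exists>a\<in>R. adj Z2 p a)" for p
    by (rule mem_boundary_iff[OF ugraph_Z2]) simp
  have bdI: "q \<in> boundary Z2 R" if "q \<notin> R" "a \<in> R" "adj Z2 q a" for q a
    using bd that by blast
  have side: "(int m + 1, 0) \<in> boundary Z2 R"
    by (rule bdI[of _ "(int m, 0)"]) (auto simp: R_def adj_Z2)
  have par: "even (dep (f (0, 0))) \<longleftrightarrow> even (dep (\<omega> e (0, 0)))"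
    if f: "f \<in> Hom Z2 H" "\<forall>x\<in>boundary Z2 R. f x = \<omega> e x" for f e
  proof -
    have wk: "(adj Z2 ^^ (m + 1)) (0, 0) (int m + 1, 0)"
      using relpowp_Z2_right[of "m + 1" 0 0] by (simp add: add.commute)
    show ?thesis
      using dep_walk_parity[OF nl f(1) wk] dep_walk_parity[OF nl Hom[of e] wk] f(2) side by simp
  qed
  show "\<exists>R z \<omega>\<^sub>1 \<omega>\<^sub>2. separated_from_afar Z2 H m R z \<omega>\<^sub>1 \<omega>\<^sub>2"
      unfolding separated_from_afar_def
  proof (rule exI[of _ R], rule exI[of _ "(0 :: int, 0 :: int)"], rule exI[of _ "\<omega> 0"],
      rule exI[of _ "\<omega> 1"], intro conjI ballI impI)
    show "enat m \<le> gsetdist Z2 {(0, 0)} (disagreement (boundary Z2 R) (\<omega> 0) (\<omega> 1))"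
    proof (rule gsetdist_Z2_ge)
      fix x y assume "(x, y) \<in> disagreement (boundary Z2 R) (\<omega> 0) (\<omega> 1)"
      then have "(x, y) \<notin> R" using bd by (auto simp: disagreement_def)
      then show "int m \<le> \<bar>0 - x\<bar> + \<bar>0 - y\<bar>" by (auto simp: R_def)
    qed
    fix f1 f2 assume f: "f1 \<in> Hom Z2 H" "f2 \<in> Hom Z2 H"
      "\<forall>x\<in>boundary Z2 R. f1 x = \<omega> 0 x" "\<forall>x\<in>boundary Z2 R. f2 x = \<omega> 1 x"
    have "even (dep u) \<longleftrightarrow> odd (dep w)" by (rule adj_cases[OF uw]) (use uw nl in auto)
    then show "f1 (0, 0) \<noteq> f2 (0, 0)"
      using par[OF f(1,3)] par[OF f(2,4)] by (auto simp: \<omega>_def)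
  qed (use Hom in \<open>auto simp: R_def\<close>)
qed

text \<open>Let \<open>v = p 0\<close>, \<open>p 1\<close>, ..., \<open>p k\<close> be the branch from \<open>v\<close> up to the first looped ancestor; here \<open>k \<ge> 2\<close>.
  In a horizontal strip of \<open>k\<close> rows between a row of \<open>p 0\<close> and a row of \<open>p k\<close>, each column is a walk of
  \<open>k + 1\<close> steps between vertices at distance \<open>k\<close>. It has one step to spare, which can only be spent on
  the loop at \<open>p 0\<close> or on the loop at \<open>p k\<close>. Neighbouring columns cannot make the same choice, as
  \<open>p 1\<close> has no loop. The columns therefore alternate, and the ends of the strip determine its middle.\<close>

lemma rigid_of_loop_gap:
  assumes r: "adj H r r" and v: "adj H v v" and gap: "\<not> adj H (par v) (par v)"
  shows "long_range_rigid Z2 H"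
proof -
  define p where "p i = (par ^^ i) v" for i
  have vH: "v \<in> verts H" using adj_in_vertsH[OF v] by auto
  define k where "k = (LEAST k. 0 < k \<and> adj H (p k) (p k))"
  have "par r = r" using par_pow_eq_root_iff[OF root_in_verts, of 1] by simp
  then have "0 < dep v" using dep_eq_0_iff[OF vH] r gap by (cases "dep v") auto
  moreover have "p (dep v) = r" unfolding p_def using par_pow_eq_root_iff[OF vH] by simp
  ultimately have ex: "0 < dep v \<and> adj H (p (dep v)) (p (dep v))" using r by simp
  have k: "0 < k" "adj H (p k) (p k)" "k \<le> dep v"
    using LeastI[of "\<lambda>k. 0 < k \<and> adj H (p k) (p k)", OF ex] Least_le[of "\<lambda>k. 0 < k \<and> adj H (p k) (p k)", OF ex]
    unfolding k_def by auto
  have "k \<noteq> 1" using k(2) gap by (auto simp: p_def)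
  then have k2: "2 \<le> k" using k(1) by simp
  have dep_p: "dep (p i) = dep v - i" for i unfolding p_def by (rule dep_par_pow[OF vH])
  have pH: "p i \<in> verts H" for i unfolding p_def by (rule par_pow_in_verts[OF vH])
  have pS: "p (Suc i) = par (p i)" for i by (simp add: p_def)
  have p0: "p 0 = v" by (simp add: p_def)
  have padj: "adj H (p i) (p (Suc i))" if "i < k" for i
  proof -
    have "dep (p i) \<noteq> dep (p (Suc i))" unfolding dep_p using that k(3) by linarith
    then have "p i \<noteq> p (Suc i)" by auto
    then show ?thesis using adj_iff_par[OF pH[of i] pH[of "Suc i"]] pS[of i] by simp
  qed
  have p01: "p 0 \<noteq> p 1" using v gap pS[of 0] p0 by auto
  define clamp where "clamp t = nat (max 0 (min (int k) t))" for t
  have clamp_adj1: "adj H (p (clamp t)) (p (clamp (t + 1)))" for t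
  proof -
    consider "t < 0" | "int k \<le> t" | "0 \<le> t" "t < int k" by linarith
    then show ?thesis
    proof cases
      case 3
      then have "clamp t = nat t" "clamp (t + 1) = Suc (nat t)" "nat t < k" by (auto simp: clamp_def)
      then show ?thesis using padj by simp
    qed (use v k(2) p0 in \<open>auto simp: clamp_def\<close>)
  qed
  have clamp_adj: "adj H (p (clamp s)) (p (clamp t))" if "\<bar>s - t\<bar> = 1" for s t
  proof -
    have "t = s + 1 \<or> s = t + 1" using that by linarith
    then show ?thesis using clamp_adj1[of s] clamp_adj1[of t] by (auto simp: adj_commute)
  qed
  \<comment> \<open>The two alternating patterns.\<close>
  define \<omega> where "\<omega> e = (\<lambda>(x, y). p (clamp (y - (x + e) mod 2)))" for e :: int
  have Hom: "\<omega> e \<in> Hom Z2 H" for e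
  proof (rule HomI)
    show "\<omega> e x \<in> verts H" for x using pH by (auto simp: \<omega>_def split: prod.split)
    fix a b :: "int \<times> int" assume ab: "adj Z2 a b"
    obtain x y x' y' where xy: "a = (x, y)" "b = (x', y')" by (cases a; cases b)
    have "\<bar>x - x'\<bar> + \<bar>y - y'\<bar> = 1" using ab by (simp add: adj_Z2 xy)
    then have c: "x' = x \<and> \<bar>y - y'\<bar> = 1 \<or> (x' = x + 1 \<or> x' = x - 1) \<and> y' = y" by linarith
    have "\<bar>(a + 1) mod 2 - a mod 2\<bar> = 1" for a :: int by presburger
    from this[of "x + e"] this[of "x - 1 + e"]
    have "\<bar>(y - (x + e) mod 2) - (y' - (x' + e) mod 2)\<bar> = 1"
      using c by (auto simp: algebra_simps abs_minus_commute)
    then show "adj H (\<omega> e a) (\<omega> e b)" using clamp_adj by (simp add: \<omega>_def xy)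
  qed simp
  show ?thesis
    unfolding long_range_rigid_def
  proof
    fix m :: nat
    define R where "R = {- int m..int m} \<times> {1..int k}"
    have bd: "q \<in> boundary Z2 R \<longleftrightarrow> q \<notin> R \<and> (\<exists>a\<in>R. adj Z2 q a)" for q
      by (rule mem_boundary_iff[OF ugraph_Z2]) simp
    have bdI: "q \<in> boundary Z2 R" if "q \<notin> R" "a \<in> R" "adj Z2 q a" for q a
      using bd that by blast
    have low: "(i, 0) \<in> boundary Z2 R" if "\<bar>i\<bar> \<le> int m" for i
      by (rule bdI[of _ "(i, 1)"]) (use that k2 in \<open>auto simp: R_def adj_Z2\<close>)
    have high: "(i, int k + 1) \<in> boundary Z2 R" if "\<bar>i\<bar> \<le> int m" for i
      by (rule bdI[of _ "(i, int k)"]) (use that k2 in \<open>auto simp: R_def adj_Z2\<close>)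
    have side: "(int m + 1, j) \<in> boundary Z2 R" if "1 \<le> j" "j \<le> int k" for j
      by (rule bdI[of _ "(int m, j)"]) (use that k2 in \<open>auto simp: R_def adj_Z2\<close>)
    have mod2: "(i + e) mod 2 = (if even (i + e) then 0 else 1)" for i e :: int by presburger
    have row1: "\<omega> e (i, 1) = (if even (i + e) then p 1 else p 0)" for e i
      using k2 by (simp add: \<omega>_def clamp_def mod2 del: even_add)
    have row2: "\<omega> e (i, 2) = p 1" if "odd (i + e)" for e i
    proof -
      have "(i + e) mod 2 = 1" using that by presburger
      then show ?thesis using k2 by (simp add: \<omega>_def clamp_def)
    qed
    have flat: "\<omega> e (i, 0) = p 0" "\<omega> e (i, int k + 1) = p k" for e i
      by (auto simp: \<omega>_def clamp_def)
    have forced: "f (0, 1) = \<omega> e (0, 1)"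
      if f: "f \<in> Hom Z2 H" and fb: "\<forall>x\<in>boundary Z2 R. f x = \<omega> e x" for f e
    proof -
      \<comment> \<open>The depth has to drop by \<open>k\<close> from row 0 to row \<open>k + 1\<close>, so at most one step of a column can fail to go up.\<close>
      have col: "f (i, 1) = p 1 \<or> f (i, 1) = p 0 \<and> f (i, 2) = p 1" if i: "0 \<le> i" "i \<le> int m + 1" for i
      proof (cases "i = int m + 1")
        case True
        have "f (i, 1) = \<omega> e (i, 1)" "f (i, 2) = \<omega> e (i, 2)" using fb side k2 True by auto
        then show ?thesis using row1[of e i] row2[of i e] by auto
      next
        case False
        then have im: "\<bar>i\<bar> \<le> int m" using i by simp
        have f0: "f (i, 0) = p 0" and fk: "f (i, int k + 1) = p k"
          using fb low[OF im] high[OF im] flat by auto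
        have "dep (f (i, 1)) \<le> dep (p k) + k" "dep (f (i, 2)) \<le> dep (p k) + (k - 1)"
          using dep_walk_le[OF f relpowp_Z2_up[of k i 1]] dep_walk_le[OF f relpowp_Z2_up[of "k - 1" i 2]] fk k2
          by (auto simp: add.commute)
        then have d: "dep (f (i, 1)) \<le> dep v" "dep (f (i, 2)) < dep v"
          using dep_p k k2 by auto
        have "adj H (f (i, 0)) (f (i, 1))" "adj H (f (i, 1)) (f (i, 2))"
          by (auto intro!: Hom_adj[OF f] simp: adj_Z2)
        then have a: "adj H v (f (i, 1))" and a2: "adj H (f (i, 1)) (f (i, 2))" using f0 p0 by auto
        show ?thesis
        proof (cases "f (i, 1) = v")
          case True
          have "adj H v (f (i, 2))" using a2 True by simp
          then have "f (i, 2) = par v" by (rule adj_cases) (use d in auto)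
          then show ?thesis using True p0 pS[of 0] by simp
        next
          case False
          from a have "f (i, 1) = par v" by (rule adj_cases) (use d False in auto)
          then show ?thesis using p0 pS[of 0] by simp
        qed
      qed
      have alt: "f (i, 1) = p 1 \<longleftrightarrow> f (i + 1, 1) = p 0" if i: "0 \<le> i" "i \<le> int m" for i
      proof -
        have "adj H (f (i, 1)) (f (i + 1, 1))" "adj H (f (i, 2)) (f (i + 1, 2))"
          by (auto intro!: Hom_adj[OF f] simp: adj_Z2)
        moreover have "\<not> adj H (p 1) (p 1)" using gap pS[of 0] p0 by simp
        ultimately show ?thesis using col[of i] col[of "i + 1"] i p01 by auto
      qed
      have "f (int m + 1 - int n, 1) = \<omega> e (int m + 1 - int n, 1)" if "n \<le> m + 1" for n
        using that
      proof (induction n)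
        case 0
        then show ?case using fb side[of 1] k2 by simp
      next
        case (Suc n)
        let ?i = "int m + 1 - int (Suc n)"
        have i: "0 \<le> ?i" "?i \<le> int m" "?i + 1 = int m + 1 - int n" using Suc.prems by auto
        have "f (?i + 1, 1) = \<omega> e (?i + 1, 1)" using Suc.IH Suc.prems unfolding i(3) by simp
        then show ?case
          using alt[OF i(1,2)] col[of ?i] i(1,2) row1[of e ?i] row1[of e "?i + 1"] p01 by auto
      qed
      from this[of "m + 1"] show ?thesis by simp
    qed
    show "\<exists>R z \<omega>\<^sub>1 \<omega>\<^sub>2. separated_from_afar Z2 H m R z \<omega>\<^sub>1 \<omega>\<^sub>2"
      unfolding separated_from_afar_def
    proof (rule exI[of _ R], rule exI[of _ "(0 :: int, 1 :: int)"], rule exI[of _ "\<omega> 0"],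
      rule exI[of _ "\<omega> 1"], intro conjI ballI impI)
      show "enat m \<le> gsetdist Z2 {(0, 1)} (disagreement (boundary Z2 R) (\<omega> 0) (\<omega> 1))"
      proof (rule gsetdist_Z2_ge)
        fix x y assume "(x, y) \<in> disagreement (boundary Z2 R) (\<omega> 0) (\<omega> 1)"
        then have q: "(x, y) \<in> boundary Z2 R" "\<omega> 0 (x, y) \<noteq> \<omega> 1 (x, y)"
          by (auto simp: disagreement_def)
        then obtain a where a: "a \<in> R" "adj Z2 (x, y) a" "(x, y) \<notin> R" using bd by blast
        have "y \<noteq> 0" "y \<noteq> int k + 1" using q(2) flat by auto
        then have "int m < \<bar>x\<bar>" using a by (cases a) (auto simp: R_def adj_Z2)
        then show "int m \<le> \<bar>0 - x\<bar> + \<bar>1 - y\<bar>" by simp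
      qed
      show "f1 (0, 1) \<noteq> f2 (0, 1)"
        if "f1 \<in> Hom Z2 H" "f2 \<in> Hom Z2 H" "\<forall>x\<in>boundary Z2 R. f1 x = \<omega> 0 x" "\<forall>x\<in>boundary Z2 R. f2 x = \<omega> 1 x"
        for f1 f2
        using forced[OF that(1,3)] forced[OF that(2,4)] row1[of 0 0] row1[of 1 0] p01 by simp
    qed (use Hom k2 in \<open>auto simp: R_def\<close>)
  qed
qed

end

section \<open>Every looped tree can be rooted\<close>

lemma adj_looped:
  assumes "u \<noteq> v"
  shows "adj \<lparr>verts = V, edges = E \<union> {{v} | v. v \<in> L}\<rparr> u v \<longleftrightarrow> {u, v} \<in> E"
  using assms by (auto simp: adj_def doubleton_eq_iff)

text \<open>The depth is the distance from \<open>r\<close> in the tree without loops, and a parent is a neighbour that is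
  closer to \<open>r\<close>. An edge between \<open>u\<close> and \<open>v\<close> other than the edges to their parents closes a cycle: go up
  from \<open>u\<close> until the branch from \<open>v\<close> to the root is met, and descend that branch to \<open>v\<close>.\<close>

lemma rooted_tree_exists:
  assumes T0: "tree T0" and L: "L \<subseteq> verts T0" and fin: "finite (verts T0)" and r: "r \<in> verts T0"
  shows "\<exists>par dep. rooted_tree \<lparr>verts = verts T0, edges = edges T0 \<union> {{v} | v. v \<in> L}\<rparr> r par dep"
proof -
  let ?H = "\<lparr>verts = verts T0, edges = edges T0 \<union> {{v} | v. v \<in> L}\<rparr>"
  have G: "ugraph T0" and con: "connected_graph T0" and nc: "\<And>c. \<not> cycle T0 c"
    using T0 by (auto simp: tree_def)
  define dep where "dep v = (LEAST n. (adj T0 ^^ n) r v)" for v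
  have ex: "\<exists>n. (adj T0 ^^ n) r v" if v: "v \<in> verts T0" for v
  proof -
    obtain p where p: "walk T0 p" "hd p = r" "last p = v" using con r v by (auto simp: connected_graph_def)
    then have "length p = Suc (length p - 1)" by (cases p) (auto simp: walk_def)
    then show ?thesis using p relpowp_adj_iff_walk[OF G r] by blast
  qed
  have dep: "(adj T0 ^^ dep v) r v" if "v \<in> verts T0" for v
    unfolding dep_def using ex[OF that] by (rule LeastI_ex)
  have dep_le: "dep v \<le> n" if "(adj T0 ^^ n) r v" for v n
    unfolding dep_def using that by (rule Least_le)
  have dep0: "dep v = 0 \<longleftrightarrow> v = r" if "v \<in> verts T0" for v
    using dep[OF that] dep_le[of 0 r] by auto
  have ex_par: "\<exists>u. adj T0 u v \<and> dep v = Suc (dep u)" if v: "v \<in> verts T0" "v \<noteq> r" for v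
  proof -
    obtain n where n: "dep v = Suc n" using dep0 v by (cases "dep v") auto
    then obtain u where u: "(adj T0 ^^ n) r u" "adj T0 u v" using dep[OF v(1)] by auto
    have uv: "u \<in> verts T0" using adj_in_verts(1)[OF G u(2)] .
    have "(adj T0 ^^ Suc (dep u)) r v" using dep[OF uv] u(2) by auto
    then have "dep v \<le> Suc (dep u)" by (rule dep_le)
    then show ?thesis using dep_le[OF u(1)] n u(2) by (intro exI[of _ u]) auto
  qed
  define par where "par v = (if v = r then r else SOME u. adj T0 u v \<and> dep v = Suc (dep u))" for v
  have par: "adj T0 (par v) v" "dep v = Suc (dep (par v))" if "v \<in> verts T0" "v \<noteq> r" for v
    using someI_ex[OF ex_par[OF that]] that by (auto simp: par_def)
  have par_r: "par r = r" by (simp add: par_def)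
  have parV: "par v \<in> verts T0" if "v \<in> verts T0" for v
    using adj_in_verts(1)[OF G par(1)] that r by (cases "v = r") (auto simp: par_r)
  have dep_par: "dep (par v) = dep v - 1" if "v \<in> verts T0" for v
    using par(2)[OF that] dep0[OF that] by (cases "v = r") (auto simp: par_r)
  have powV: "(par ^^ k) v \<in> verts T0" if "v \<in> verts T0" for v k
    using that by (induction k) (auto intro: parV)
  have dep_pow: "dep ((par ^^ k) v) = dep v - k" if "v \<in> verts T0" for v k
    using that by (induction k) (auto simp: dep_par powV)
  have only: "u = par v \<or> v = par u" if uv: "adj T0 u v" for u v
  proof (rule ccontr)
    assume not: "\<not> (u = par v \<or> v = par u)"
    have V: "u \<in> verts T0" "v \<in> verts T0" using adj_in_verts[OF G uv] by auto
    define Q where "Q i \<longleftrightarrow> (\<exists>j\<le>dep v. (par ^^ i) u = (par ^^ j) v)" for i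
    have pr: "(par ^^ dep x) x = r" if "x \<in> verts T0" for x
      using dep_pow[OF that, of "dep x"] dep0[OF powV[OF that, of "dep x"]] by simp
    have "Q (dep u)" unfolding Q_def using pr[OF V(1)] pr[OF V(2)] by auto
    define i where "i = (LEAST i. Q i)"
    have "Q i" unfolding i_def by (rule LeastI) fact
    then obtain j where j: "j \<le> dep v" "(par ^^ i) u = (par ^^ j) v" by (auto simp: Q_def)
    have notQ: "\<not> Q a" if "a < i" for a using not_less_Least that unfolding i_def by blast
    have ur: "(par ^^ a) u \<noteq> r" if "a < i" for a
      using notQ[OF that] pr[OF V(2)] unfolding Q_def by (metis order_refl)
    have ua: "a < dep u" if "a < i" for a
      using ur[OF that] dep0[OF powV[OF V(1), of a]] dep_pow[OF V(1), of a] by simp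
    have vr: "(par ^^ a) v \<noteq> r" if "a < j" for a
      using that j(1) dep0[OF powV[OF V(2), of a]] dep_pow[OF V(2), of a] by simp
    have step: "adj T0 ((par ^^ a) x) ((par ^^ Suc a) x)" if "x \<in> verts T0" "(par ^^ a) x \<noteq> r" for a x
      using par(1)[OF powV[OF that(1)] that(2)] by (simp add: adj_commute)
    \<comment> \<open>\<open>i\<close> is the first step at which the branch of \<open>u\<close> meets the branch of \<open>v\<close>.\<close>
    define c1 where "c1 = map (\<lambda>a. (par ^^ a) u) [0..<i]"
    define c2 where "c2 = map (\<lambda>a. (par ^^ a) v) [0..<Suc j]"
    define c where "c = c1 @ rev c2"
    have s1: "successively (adj T0) c1"
      unfolding c1_def successively_conv_nth using step[OF V(1) ur] by simp
    have "successively (adj T0) c2"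
      unfolding c2_def successively_conv_nth using step[OF V(2) vr] by (simp del: upt_Suc)
    then have s2: "successively (adj T0) (rev c2)"
      unfolding successively_rev by (simp add: adj_commute[of T0])
    have hd2: "hd (rev c2) = (par ^^ i) u" by (simp add: c2_def hd_rev j(2))
    have mid: "c1 = [] \<or> adj T0 (last c1) (hd (rev c2))"
    proof (cases i)
      case (Suc a)
      then show ?thesis unfolding hd2 using step[OF V(1) ur[of a]] by (simp add: c1_def)
    qed (simp add: c1_def)
    have "walk T0 c"
      using s1 s2 mid powV[OF V(1)] powV[OF V(2)]
      by (auto simp: walk_def c_def successively_append_iff c1_def c2_def)
    moreover have "distinct c"
    proof -
      have "inj_on (\<lambda>a. (par ^^ a) u) {0..<i}"
      proof (rule inj_onI)
        fix a b assume "a \<in> {0..<i}" "b \<in> {0..<i}" "(par ^^ a) u = (par ^^ b) u"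
        then show "a = b" using dep_pow[OF V(1), of a] dep_pow[OF V(1), of b] ua[of a] ua[of b] by simp
      qed
      moreover have "inj_on (\<lambda>a. (par ^^ a) v) {0..<Suc j}"
      proof (rule inj_onI)
        fix a b assume "a \<in> {0..<Suc j}" "b \<in> {0..<Suc j}" "(par ^^ a) v = (par ^^ b) v"
        then show "a = b" using dep_pow[OF V(2), of a] dep_pow[OF V(2), of b] j(1) by simp
      qed
      moreover have "(par ^^ a) u \<noteq> (par ^^ b) v" if "a < i" "b < Suc j" for a b
        using notQ[OF that(1)] that(2) j(1) unfolding Q_def by auto
      ultimately show ?thesis unfolding c_def c1_def c2_def by (auto simp: distinct_map simp del: upt_Suc)
    qed
    moreover have "length c \<noteq> 2"
    proof
      assume "length c = 2"
      then have "i = 1 \<and> j = 0 \<or> i = 0 \<and> j = 1" by (auto simp: c_def c1_def c2_def)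
      then show False using j(2) not by auto
    qed
    moreover have "adj T0 (last c) (hd c)"
    proof -
      have "last c = v" by (simp add: c_def c2_def last_rev upt_conv_Cons del: upt_Suc)
      moreover have "hd c = u"
        using hd2 by (cases i) (auto simp: c_def c1_def hd_append upt_conv_Cons simp del: upt_Suc)
      ultimately show ?thesis using uv by (simp add: adj_commute)
    qed
    ultimately show False using nc by (auto simp: cycle_def)
  qed
  have "rooted_tree ?H r par dep"
  proof
    show "ugraph ?H" using G L by (fastforce simp: ugraph_def)
    show "finite (verts ?H)" "r \<in> verts ?H" using fin r by auto
    fix v assume v: "v \<in> verts ?H"
    show "par v \<in> verts ?H" "dep (par v) = dep v - 1" "dep v = 0 \<longleftrightarrow> v = r"
      using v parV dep_par dep0 by auto
  next
    fix u v assume uv: "u \<in> verts ?H" "v \<in> verts ?H" "u \<noteq> v"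
    have "adj T0 u v" if "u = par v \<or> v = par u"
      using that
    proof
      assume "u = par v"
      moreover have "v \<noteq> r" using \<open>u = par v\<close> uv(3) par_r by auto
      ultimately show ?thesis using par(1)[of v] uv(2) by simp
    next
      assume "v = par u"
      moreover have "u \<noteq> r" using \<open>v = par u\<close> uv(3) par_r by auto
      ultimately show ?thesis using par(1)[of u] uv(1) by (simp add: adj_commute)
    qed
    then show "adj ?H u v \<longleftrightarrow> u = par v \<or> v = par u"
      using only[of u v] adj_looped[OF uv(3)] by (auto simp: adj_def)
  qed
  then show ?thesis by blast
qed

section \<open>Relabelling the square lattice\<close>

text \<open>A copy of the lattice in an arbitrary infinite vertex type, as a board on which TSSM can be tested.\<close>

definition relabelled_Z2 :: "(int \<times> int \<Rightarrow> 'v) \<Rightarrow> 'v ugraph" where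
  "relabelled_Z2 f = \<lparr>verts = range f, edges = (`) f ` edges Z2\<rparr>"

context
  fixes f :: "int \<times> int \<Rightarrow> 'v"
  assumes f: "inj f"
begin

lemma adj_relabelled: "adj (relabelled_Z2 f) a b \<longleftrightarrow> (\<exists>x y. a = f x \<and> b = f y \<and> adj Z2 x y)"
proof -
  have "{a, b} \<in> (`) f ` edges Z2 \<longleftrightarrow> (\<exists>x y. a = f x \<and> b = f y \<and> {x, y} \<in> edges Z2)"
  proof
    assume "{a, b} \<in> (`) f ` edges Z2"
    then obtain e where e: "e \<in> edges Z2" "{a, b} = f ` e" by blast
    then obtain x y where "e = {x, y}" by (auto simp: Z2_def)
    then have "{a, b} = {f x, f y}" "{x, y} \<in> edges Z2" "{y, x} \<in> edges Z2"
      using e by (auto simp: insert_commute)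
    then show "\<exists>x y. a = f x \<and> b = f y \<and> {x, y} \<in> edges Z2"
      unfolding doubleton_eq_iff by blast
  next
    assume "\<exists>x y. a = f x \<and> b = f y \<and> {x, y} \<in> edges Z2"
    then obtain x y where "{a, b} = f ` {x, y}" "{x, y} \<in> edges Z2" by auto
    then show "{a, b} \<in> (`) f ` edges Z2" by blast
  qed
  then show ?thesis by (simp add: adj_def relabelled_Z2_def)
qed

lemma ugraph_relabelled: "ugraph (relabelled_Z2 f)"
  by (auto simp: ugraph_def relabelled_Z2_def Z2_def) blast

lemma relpowp_relabelled: "(adj (relabelled_Z2 f) ^^ n) (f x) b \<longleftrightarrow> (\<exists>y. b = f y \<and> (adj Z2 ^^ n) x y)"
proof (induction n arbitrary: b)
  case (Suc n)
  then show ?case by (auto simp: relcompp_apply adj_relabelled inj_eq[OF f]) blast+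
qed (auto simp del: split_paired_Ex)

lemma board_relabelled: "board (relabelled_Z2 f)"
  unfolding board_def
proof (intro conjI allI ballI)
  show "ugraph (relabelled_Z2 f)" by (rule ugraph_relabelled)
  show "countable (verts (relabelled_Z2 f))" by (simp add: relabelled_Z2_def)
  show "\<not> adj (relabelled_Z2 f) v v" for v by (auto simp: adj_relabelled inj_eq[OF f] adj_Z2)
  show "connected_graph (relabelled_Z2 f)"
    unfolding connected_graph_def
  proof (intro ballI)
    fix u v assume uv: "u \<in> verts (relabelled_Z2 f)" "v \<in> verts (relabelled_Z2 f)"
    then obtain x y where "u = f x" "v = f y" by (auto simp: relabelled_Z2_def)
    then obtain n where "(adj (relabelled_Z2 f) ^^ n) u v"
      using walk_Z2_exists[of x y] relpowp_relabelled by blast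
    then show "\<exists>p. walk (relabelled_Z2 f) p \<and> hd p = u \<and> last p = v"
      using relpowp_adj_iff_walk[OF ugraph_relabelled uv(1)] by blast
  qed
  show "finite {w. adj (relabelled_Z2 f) v w}" if v: "v \<in> verts (relabelled_Z2 f)" for v
  proof -
    obtain x where "v = f x" using v unfolding relabelled_Z2_def ugraph.select_convs by blast
    then have "{w. adj (relabelled_Z2 f) v w} = f ` {y. adj Z2 x y}"
      by (auto simp: adj_relabelled inj_eq[OF f])
    then show ?thesis by (simp add: neighbours_Z2)
  qed
  have "f (0, 0) \<noteq> f (0, 1)" by (simp add: inj_eq[OF f])
  then show "\<exists>u\<in>verts (relabelled_Z2 f). \<exists>v\<in>verts (relabelled_Z2 f). u \<noteq> v"
    by (auto simp: relabelled_Z2_def)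
qed

lemma TSSM_relabelled:
  assumes "TSSM (relabelled_Z2 f) H"
  shows "TSSM Z2 H"
proof -
  let ?G = "relabelled_Z2 f"
  obtain g where g: "\<forall>A B S.
     finite A \<and> finite B \<and> finite S \<and> A \<subseteq> verts ?G \<and> B \<subseteq> verts ?G \<and> S \<subseteq> verts ?G \<and>
     A \<inter> B = {} \<and> A \<inter> S = {} \<and> B \<inter> S = {} \<and> gsetdist ?G A B \<ge> enat g \<longrightarrow>
     (\<forall>\<omega>\<^sub>1\<in>Hom ?G H. \<forall>\<omega>\<^sub>2\<in>Hom ?G H. (\<forall>x\<in>S. \<omega>\<^sub>1 x = \<omega>\<^sub>2 x) \<longrightarrow>
       (\<exists>\<omega>\<in>Hom ?G H. (\<forall>x\<in>A \<union> S. \<omega> x = \<omega>\<^sub>1 x) \<and> (\<forall>x\<in>B. \<omega> x = \<omega>\<^sub>2 x)))"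
    using assms unfolding TSSM_iff_points by (rule exE)
  define push where "push \<omega> = restrict (\<omega> \<circ> inv f) (range f)" for \<omega> :: "int \<times> int \<Rightarrow> 'a"
  have push: "push \<omega> (f x) = \<omega> x" for \<omega> x using f by (simp add: push_def)
  have pushH: "push \<omega> \<in> Hom ?G H" if w: "\<omega> \<in> Hom Z2 H" for \<omega>
  proof (rule HomI)
    show "push \<omega> a \<in> verts H" if "a \<in> verts ?G" for a
      using that Hom_in_verts[OF w] by (auto simp: relabelled_Z2_def push)
    show "push \<omega> a = undefined" if "a \<notin> verts ?G" for a
      using that by (simp add: relabelled_Z2_def push_def)
    show "adj H (push \<omega> a) (push \<omega> b)" if "adj ?G a b" for a b
      using that Hom_adj[OF w] by (auto simp: adj_relabelled push)
  qed
  show ?thesis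
    unfolding TSSM_iff_points
  proof (intro exI[of _ g] allI impI ballI, elim conjE)
    fix A B S :: "(int \<times> int) set" and \<omega>1 \<omega>2
    assume fin: "finite A" "finite B" "finite S"
      and disj: "A \<inter> B = {}" "A \<inter> S = {}" "B \<inter> S = {}" and dist: "enat g \<le> gsetdist Z2 A B"
      and w: "\<omega>1 \<in> Hom Z2 H" "\<omega>2 \<in> Hom Z2 H" "\<forall>x\<in>S. \<omega>1 x = \<omega>2 x"
    have "\<exists>\<omega>\<in>Hom ?G H. (\<forall>x\<in>f ` A \<union> f ` S. \<omega> x = push \<omega>1 x) \<and> (\<forall>x\<in>f ` B. \<omega> x = push \<omega>2 x)"
    proof (rule g[rule_format, OF _ pushH[OF w(1)] pushH[OF w(2)]], intro conjI)
      have "f ` A \<subseteq> verts ?G" by (auto simp: relabelled_Z2_def)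
      from gsetdist_ge_iff[OF ugraph_relabelled this, of g "f ` B"]
      show "enat g \<le> gsetdist ?G (f ` A) (f ` B)"
        using dist gsetdist_ge_iff[OF ugraph_Z2, of A g B]
        by (auto simp: relpowp_relabelled inj_eq[OF f])
      show "push \<omega>1 x = push \<omega>2 x" if "x \<in> f ` S" for x using w(3) that by (auto simp: push)
    qed (use fin disj in \<open>auto simp: relabelled_Z2_def inj_eq[OF f] image_Int[OF f, symmetric]\<close>)
    then obtain \<omega> where "\<omega> \<in> Hom ?G H" "\<forall>x\<in>f ` A \<union> f ` S. \<omega> x = push \<omega>1 x"
      "\<forall>x\<in>f ` B. \<omega> x = push \<omega>2 x" by blast
    then have \<omega>: "\<omega> \<in> Hom ?G H" "\<forall>x\<in>A \<union> S. \<omega> (f x) = \<omega>1 x" "\<forall>x\<in>B. \<omega> (f x) = \<omega>2 x"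
      unfolding image_Un[symmetric] by (simp_all add: push)
    have "\<omega> \<circ> f \<in> Hom Z2 H"
    proof (rule HomI)
      show "(\<omega> \<circ> f) x \<in> verts H" for x
        using Hom_in_verts[OF \<omega>(1), of "f x"] by (simp add: relabelled_Z2_def)
      show "adj H ((\<omega> \<circ> f) x) ((\<omega> \<circ> f) y)" if "adj Z2 x y" for x y
      proof -
        have "adj ?G (f x) (f y)" using that unfolding adj_relabelled by blast
        then show ?thesis using Hom_adj[OF \<omega>(1)] by simp
      qed
    qed simp
    then show "\<exists>\<omega>\<in>Hom Z2 H. (\<forall>x\<in>A \<union> S. \<omega> x = \<omega>1 x) \<and> (\<forall>x\<in>B. \<omega> x = \<omega>2 x)"
      using \<omega>(2,3) by (intro bexI[of _ "\<omega> \<circ> f"]) auto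
  qed
qed

end

section \<open>The equivalence\<close>

lemma board_has_edge:
  assumes "board G"
  shows "\<exists>x y. adj G x y"
proof -
  obtain u v where uv: "u \<in> verts G" "v \<in> verts G" "u \<noteq> v" using assms by (auto simp: board_def)
  then obtain p where p: "walk G p" "hd p = u" "last p = v"
    using assms unfolding board_def connected_graph_def by blast
  have "length p = Suc (length p - 1)" using p(1) by (cases p) (auto simp: walk_def)
  then have "(adj G ^^ (length p - 1)) u v"
    using relpowp_adj_iff_walk[of G u] assms uv(1) p by (auto simp: board_def)
  then show ?thesis using uv(3) by (cases "length p - 1") auto
qed

(* Boards are countable, so any infinite vertex type 'v contains every board up to isomorphism. *)
theorem proposition8p2:
  fixes T :: "'a ugraph"
  assumes "looped_tree T" and "finite (verts T)"
  shows "((\<forall>G :: 'v::infinite ugraph. board G \<longrightarrow> TSSM G T) \<longleftrightarrow> TSSM Z2 T) \<and>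
         (TSSM Z2 T \<longleftrightarrow> (\<forall>\<gamma>>0. \<exists>\<Phi>. nn_interaction T \<Phi> \<and> exp_SSM Z2 T \<Phi> \<gamma>))"
proof -
  obtain T0 L where T: "tree T0" "L \<subseteq> verts T0"
    "T = \<lparr>verts = verts T0, edges = edges T0 \<union> {{v} | v. v \<in> L}\<rparr>"
    using assms(1) by (auto simp: looped_tree_def)
  have rooted: "\<exists>par dep. rooted_tree T r par dep" if "r \<in> verts T" for r
    using rooted_tree_exists[OF T(1,2)] assms(2) that unfolding T(3) by simp
  have uT: "ugraph T" using T by (fastforce simp: tree_def ugraph_def)
  have all_hold: ?thesis
    if "\<And>G :: 'v ugraph. board G \<Longrightarrow> TSSM G T" "TSSM Z2 T"
      "\<And>\<gamma>. \<gamma> > 0 \<Longrightarrow> \<exists>\<Phi>. nn_interaction T \<Phi> \<and> exp_SSM Z2 T \<Phi> \<gamma>"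
    using that by blast
  have all_fail: ?thesis if rig: "long_range_rigid Z2 T"
  proof -
    have "\<not> TSSM Z2 T" using rigid_not_TSSM[OF rig ugraph_Z2] by (simp add: neighbours_Z2)
    moreover have "\<not> exp_SSM Z2 T \<Phi> 1" for \<Phi>
      using rigid_not_SSM[OF rig ugraph_Z2 assms(2)] by simp
    moreover have "\<exists>G :: 'v ugraph. board G \<and> \<not> TSSM G T"
    proof -
      obtain h :: "nat \<Rightarrow> 'v" where "inj h" using infinite_countable_subset[OF infinite_UNIV] by blast
      then have "inj (h \<circ> to_nat :: int \<times> int \<Rightarrow> 'v)" by (intro inj_compose inj_to_nat)
      then show ?thesis using board_relabelled TSSM_relabelled \<open>\<not> TSSM Z2 T\<close> by blast
    qed
    ultimately show ?thesis by (metis zero_less_one)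
  qed
  consider (edgeless) "\<And>u w. \<not> adj T u w" | (loopless) u w where "adj T u w" "\<And>v. \<not> adj T v v"
    | (loop) r where "adj T r r" by blast
  then show ?thesis
  proof cases
    case edgeless
    \<comment> \<open>A graph without edges admits no point on any board, so all three statements are void.\<close>
    have emptyb: "Hom G T = {}" if "board G" for G :: "'v ugraph"
      using board_has_edge[OF that] edgeless by (auto simp: Hom_def)
    have emptyZ: "Hom Z2 T = {}"
      using edgeless adj_Z2[of "(0, 0)" "(0, 1)"] by (auto simp: Hom_def)
    show ?thesis
    proof (rule all_hold)
      show "TSSM G T" if "board G" for G :: "'v ugraph" using emptyb[OF that] by (simp add: TSSM_iff_points)
      show "TSSM Z2 T" using emptyZ by (simp add: TSSM_iff_points)
      show "\<exists>\<Phi>. nn_interaction T \<Phi> \<and> exp_SSM Z2 T \<Phi> \<gamma>" if "\<gamma> > 0" for \<gamma>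
        using emptyZ by (intro exI[of _ "\<lambda>_. 0"]) (auto simp: nn_interaction_def exp_SSM_def intro: exI[of _ 1])
    qed
  next
    case loopless
    obtain par dep where "rooted_tree T u par dep" using rooted adj_in_verts(1)[OF uT loopless(1)] by blast
    then interpret rooted_tree T u par dep .
    show ?thesis using all_fail rigid_of_no_loops loopless by blast
  next
    case loop
    obtain par dep where "rooted_tree T r par dep" using rooted adj_in_verts(1)[OF uT loop] by blast
    then interpret rooted_tree T r par dep .
    show ?thesis
    proof (cases "\<forall>v. adj T v v \<longrightarrow> adj T (par v) (par v)")
      case True
      interpret loop_rooted_tree T r par dep by unfold_locales (use loop True in auto)
      show ?thesis
        by (rule all_hold[OF TSSM_of_loop_rooted TSSM_of_loop_rooted[OF ugraph_Z2]
              exp_SSM_of_loop_rooted[OF ugraph_Z2 degree_bound_Z2]]) (auto simp: board_def)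
    next
      case False
      then show ?thesis using all_fail rigid_of_loop_gap loop by blast
    qed
  qed
qed

end
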